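(* Let $S(z,\mathbf t)$ be a solution of the dispersionless BKP hierarchy with $\tau$-function $F(\mathbf t)$, $\mathbf t=(t_1,t_3,t_5,\dots)$, and put $x=t_1$, $y=t_3$, $p(z)=\partial_xS(z)$, $u=-\partial_x\widetilde S_1$. Let $\zeta_1,\dots,\zeta_N$ be points of $\mathbb C$, $c_1,\dots,c_N$ constants, $p_i=p(\zeta_i)$, $\phi_i=\partial_xS_z(\zeta_i)$, and impose the symmetry constraint $$F_x=\frac12\sum_{i=1}^Nc_iS_z(\zeta_i).$$ Then in terms of $u$ the constraint reads $u=\sum_{i=1}^Nc_i\phi_i$; the first system of the constrained hierarchy is, for $k=1,\dots,N$, $$\partial_yp_k=\partial_x\Bigl(p_k^3+3p_k\sum_ic_i\phi_i\Bigr),\qquad \partial_y\phi_k=\partial_x\Bigl(3p_k^2\phi_k+3\phi_k\sum_ic_i\phi_i\Bigr);$$ and the Sato function $z(p)$ of the constrained hierarchy, relating $z$ and $p=p(z)$, is $$z=p+\sum_{i=1}^Nc_i\frac{p\,\phi_i}{p^2-p_i^2}.$$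
   Context: The B-type quasiclassical vertex operator is $\mathcal D(z)=2\sum_{n=0}^\infty\frac{z^{-(2n+1)}}{2n+1}\frac{\partial}{\partial t_{2n+1}}$, $|z|>1$. A solution of the dispersionless BKP hierarchy is a function $S=S_0+\widetilde S$ solving a nonlinear Beltrami equation $S_{\bar z}=W(z,\bar z,S_z)$ with $W$ localized in the unit disc and $W(-z,-\bar z,\eta)=W(z,\bar z,\eta)$, where $S_z=\partial_zS$, $S_{\bar z}=\partial_{\bar z}S$, $S_0(z,\mathbf t)=\sum_{n\ge0}t_{2n+1}z^{2n+1}$, $S(-z,\mathbf t)=-S(z,\mathbf t)$, and $\widetilde S$ is analytic in $z$ outside the unit disc with $\widetilde S=\sum_{i\ge1}\widetilde S_i(\mathbf t)z^{-i}$ at infinity. It satisfies, with $p(z)=\partial_{t_1}S(z)$, $$\frac{p(z_1)-p(z)}{p(z_1)+p(z)}=\exp(-\mathcal D(z_1)S(z)),\qquad z\in\mathbb C,\ |z_1|>1,$$ where $\mathcal D(z_1)S_0(z)=\ln\frac{z_1+z}{z_1-z}$. Its $\tau$-function $F(\mathbf t)$ is characterized by $\widetilde S(z,\mathbf t)=-\mathcal D(z)F(\mathbf t)$. *)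

theory Defs
  imports "HOL-Complex_Analysis.Complex_Analysis"
begin

text \<open>
  The time \<open>t\<^sub>2\<^sub>n\<^sub>+\<^sub>1\<close> is stored at index \<open>n\<close>; in particular \<open>x = t\<^sub>1\<close> is coordinate 0 and
  \<open>y = t\<^sub>3\<close> is coordinate 1.  Times are complex, and all time derivatives are complex derivatives.
\<close>
type_synonym times = "nat \<Rightarrow> complex"

definition pd :: "nat \<Rightarrow> (times \<Rightarrow> complex) \<Rightarrow> times \<Rightarrow> complex" where
  "pd n f t = deriv (\<lambda>s. f (t(n := s))) (t n)"

abbreviation pd_x :: "(times \<Rightarrow> complex) \<Rightarrow> times \<Rightarrow> complex" where "pd_x \<equiv> pd 0"
abbreviation pd_y :: "(times \<Rightarrow> complex) \<Rightarrow> times \<Rightarrow> complex" where "pd_y \<equiv> pd 1"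

text \<open>
  Functions of infinitely many times are only ever examined along slices in which finitely many
  times vary.  On a slice the product topology of \<open>nat \<Rightarrow> complex\<close> is that of \<open>\<complex>\<^sup>n\<close>.
\<close>
definition slice :: "times \<Rightarrow> nat \<Rightarrow> times set" where
  "slice t n = {s. \<forall>k\<ge>n. s k = t k}"

definition finitely_open :: "times set \<Rightarrow> bool" where
  "finitely_open T \<longleftrightarrow> (\<forall>t\<in>T. \<forall>n. openin (top_of_set (slice t n)) (T \<inter> slice t n))"

text \<open>Holomorphic in every finite set of times (continuous and separately holomorphic).\<close>
definition time_holomorphic_on :: "times set \<Rightarrow> (times \<Rightarrow> complex) \<Rightarrow> bool" where
  "time_holomorphic_on T f \<longleftrightarrow>
     (\<forall>t\<in>T. \<forall>n. continuous_on (T \<inter> slice t n) f \<and>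
                (\<lambda>s. f (t(n := s))) field_differentiable (at (t n)))"

text \<open>Wirtinger derivatives: S is not holomorphic in z inside the unit disc.\<close>
definition wirt :: "(complex \<Rightarrow> complex) \<Rightarrow> complex \<Rightarrow> complex" where
  "wirt f z = (frechet_derivative f (at z) 1 - \<i> * frechet_derivative f (at z) \<i>) / 2"

definition wirt_bar :: "(complex \<Rightarrow> complex) \<Rightarrow> complex \<Rightarrow> complex" where
  "wirt_bar f z = (frechet_derivative f (at z) 1 + \<i> * frechet_derivative f (at z) \<i>) / 2"

definition vertex_term :: "complex \<Rightarrow> (times \<Rightarrow> complex) \<Rightarrow> times \<Rightarrow> nat \<Rightarrow> complex" where
  "vertex_term z f t n = 1 / (of_nat (2*n + 1) * z ^ (2*n + 1)) * pd n f t"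

definition vertex_op :: "complex \<Rightarrow> (times \<Rightarrow> complex) \<Rightarrow> times \<Rightarrow> complex" where
  "vertex_op z f t = 2 * (\<Sum>n. vertex_term z f t n)"

definition S_zero :: "complex \<Rightarrow> times \<Rightarrow> complex" where
  "S_zero z t = (\<Sum>n. t n * z ^ (2*n + 1))"

definition S_tilde :: "(complex \<Rightarrow> times \<Rightarrow> complex) \<Rightarrow> complex \<Rightarrow> times \<Rightarrow> complex" where
  "S_tilde S z t = S z t - S_zero z t"

definition S_z :: "(complex \<Rightarrow> times \<Rightarrow> complex) \<Rightarrow> complex \<Rightarrow> times \<Rightarrow> complex" where
  "S_z S z t = wirt (\<lambda>w. S w t) z"

definition S_zbar :: "(complex \<Rightarrow> times \<Rightarrow> complex) \<Rightarrow> complex \<Rightarrow> times \<Rightarrow> complex" where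
  "S_zbar S z t = wirt_bar (\<lambda>w. S w t) z"

definition mom :: "(complex \<Rightarrow> times \<Rightarrow> complex) \<Rightarrow> complex \<Rightarrow> times \<Rightarrow> complex" where
  "mom S z t = pd_x (S z) t"

definition phi :: "(complex \<Rightarrow> times \<Rightarrow> complex) \<Rightarrow> complex \<Rightarrow> times \<Rightarrow> complex" where
  "phi S z t = pd_x (S_z S z) t"

text \<open>
  The series for \<open>\<D>(z1) S\<^sub>0(z)\<close> converges only for \<open>|z| < |z1|\<close>, and there equals the logarithm
  below; beyond that range the logarithm is its meaning.  The choice of branch is immaterial,
  as the operator enters the hierarchy only through the exponential.
\<close>
definition vertex_S :: "(complex \<Rightarrow> times \<Rightarrow> complex) \<Rightarrow> complex \<Rightarrow> complex \<Rightarrow> times \<Rightarrow> complex" where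
  "vertex_S S z1 z t = Ln ((z1 + z) / (z1 - z)) + vertex_op z1 (S_tilde S z) t"

text \<open>
  \<open>T\<close> is the domain of times on which the solution lives, and \<open>A i\<close> is the i-th coefficient of the
  expansion of \<open>S_tilde\<close> at infinity (\<open>A 0\<close> is not used).  In \<open>generating\<close>, both sides degenerate at
  \<open>z1 = \<plusminus> z\<close>; elsewhere, since the exponential does not vanish and division by 0 gives 0, the
  equation includes that the denominator \<open>p(z1) + p(z)\<close> is nonzero.

  The generating equation is a property of solutions obtained from the Beltrami equation by a
  uniqueness argument for the linearized \<open>\<partial>\<close>-bar problem; W is too unspecific for that argument here, so
  both are part of the notion of solution.  S is C1 in (z, z-bar) and holomorphic in the times.
\<close>
locale dBKP_solution =
  fixes W :: "complex \<Rightarrow> complex \<Rightarrow> complex \<Rightarrow> complex"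
    and T :: "times set"
    and S :: "complex \<Rightarrow> times \<Rightarrow> complex"
    and A :: "nat \<Rightarrow> times \<Rightarrow> complex"
  assumes W_localized: "\<And>z \<eta>. norm z > 1 \<Longrightarrow> W z (cnj z) \<eta> = 0"
    and W_symmetric: "\<And>z \<eta>. W (- z) (- cnj z) \<eta> = W z (cnj z) \<eta>"
    and T_open: "finitely_open T"
    and S_zero_summable: "\<And>t z. t \<in> T \<Longrightarrow> summable (\<lambda>n. t n * z ^ (2*n + 1))"
    and S_time_holomorphic: "\<And>z. time_holomorphic_on T (S z)"
    and S_differentiable: "\<And>t z. t \<in> T \<Longrightarrow> (\<lambda>w. S w t) differentiable (at z)"
    and S_continuous:
      "\<And>t n. t \<in> T \<Longrightarrow> continuous_on (UNIV \<times> (T \<inter> slice t n)) (\<lambda>(z, s). S z s)"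
    and S_z_continuous:
      "\<And>t n. t \<in> T \<Longrightarrow> continuous_on (UNIV \<times> (T \<inter> slice t n)) (\<lambda>(z, s). S_z S z s)"
    and S_zbar_continuous:
      "\<And>t n. t \<in> T \<Longrightarrow> continuous_on (UNIV \<times> (T \<inter> slice t n)) (\<lambda>(z, s). S_zbar S z s)"
    and beltrami: "\<And>t z. t \<in> T \<Longrightarrow> S_zbar S z t = W z (cnj z) (S_z S z t)"
    and S_odd: "\<And>t z. t \<in> T \<Longrightarrow> S (- z) t = - S z t"
    and S_tilde_holomorphic:
      "\<And>t. t \<in> T \<Longrightarrow> (\<lambda>z. S_tilde S z t) holomorphic_on {z. norm z > 1}"
    and S_tilde_expansion:
      "\<And>t z. t \<in> T \<Longrightarrow> norm z > 1 \<Longrightarrow> (\<lambda>i. A (Suc i) t / z ^ Suc i) sums S_tilde S z t"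
    and vertex_summable:
      "\<And>t z z1. t \<in> T \<Longrightarrow> norm z1 > 1 \<Longrightarrow> summable (vertex_term z1 (S_tilde S z) t)"
    and generating:
      "\<And>t z z1. t \<in> T \<Longrightarrow> norm z1 > 1 \<Longrightarrow> z1 \<noteq> z \<Longrightarrow> z1 \<noteq> - z \<Longrightarrow>
         (mom S z1 t - mom S z t) / (mom S z1 t + mom S z t) = exp (- vertex_S S z1 z t)"

definition tau_function ::
    "times set \<Rightarrow> (complex \<Rightarrow> times \<Rightarrow> complex) \<Rightarrow> (times \<Rightarrow> complex) \<Rightarrow> bool" where
  "tau_function T S F \<longleftrightarrow> time_holomorphic_on T F \<and>
     (\<forall>t\<in>T. \<forall>z. norm z > 1 \<longrightarrow>
        summable (vertex_term z F t) \<and> S_tilde S z t = - vertex_op z F t)"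

text \<open>The potential u, in terms of the expansion coefficients \<open>A\<close> of \<open>S_tilde\<close>.\<close>
definition potential :: "(nat \<Rightarrow> times \<Rightarrow> complex) \<Rightarrow> times \<Rightarrow> complex" where
  "potential A t = - pd_x (A 1) t"

text \<open>The Sato function \<open>p \<mapsto> z(p)\<close> is the inverse of \<open>z \<mapsto> p(z)\<close> outside the unit disc.\<close>
definition sato_function :: "(complex \<Rightarrow> times \<Rightarrow> complex) \<Rightarrow> times \<Rightarrow> complex \<Rightarrow> complex" where
  "sato_function S t = the_inv_into {z. norm z > 1} (\<lambda>z. mom S z t)"

end

theory Submission
  imports Defs
begin

text \<open>
  With \<open>w = 1/z\<^sub>1\<close> and \<open>q(w) = 1/p(1/w)\<close> the generating equation reads
  \<open>\<D>(1/w) S(z) = ln ((1 + p(z) q(w)) / (1 - p(z) q(w)))\<close>. Comparing powers of \<open>w\<close>, each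
  \<open>\<partial>S(z)/\<partial>t\<^sub>2\<^sub>n\<^sub>+\<^sub>1\<close> is a polynomial in \<open>p(z)\<close> with coefficients depending on the times only, so it can be
  differentiated in \<open>z\<close> coefficient by coefficient; no uniform convergence of the vertex operator is needed.
  The coefficient of \<open>w\<^sup>3\<close> gives the \<open>y\<close>-flows \<open>\<partial>\<^sub>y S = p\<^sup>3 + 3 u p\<close>. Since the coefficients of
  \<open>S_tilde\<close> are the derivatives of \<open>F\<close>, the constraint expresses \<open>p - z = \<partial>\<^sub>x S_tilde\<close>, coefficient by
  coefficient, through the \<open>z\<close>-derivatives of that logarithm at the \<open>\<zeta>\<^sub>i\<close>. This is the Sato relation near infinity, and it extends to
  \<open>|z| > 1\<close> by analytic continuation.
\<close>

section \<open>Circle integrals depending on a parameter\<close>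

lemma continuous_on_contour_integral_circlepath:
  fixes f :: "'a::topological_space \<Rightarrow> complex \<Rightarrow> complex"
  assumes "continuous_on (U \<times> sphere c r) (\<lambda>(x, w). f x w)" "0 \<le> r"
  shows "continuous_on U (\<lambda>x. contour_integral (circlepath c r) (f x))"
proof -
  have "continuous_on (U \<times> cbox 0 1)
          (\<lambda>(x, s). f x (circlepath c r s) * (2 * pi * \<i> * r * exp (2 * of_real pi * \<i> * s)))"
    unfolding split_beta
  proof (intro continuous_intros)
    have "circlepath c r s \<in> sphere c r" if "s \<in> cbox 0 1" for s
      using that assms(2) path_image_circlepath[of c r] by (auto simp: path_image_def)
    moreover have "continuous_on (U \<times> cbox 0 1) (\<lambda>p. (fst p, circlepath c r (snd p)))"
      unfolding circlepath by (intro continuous_intros)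
    ultimately show "continuous_on (U \<times> cbox 0 1) (\<lambda>p. f (fst p) (circlepath c r (snd p)))"
      by (intro continuous_on_compose2[OF assms(1), of _ "\<lambda>p. (fst p, circlepath c r (snd p))",
            unfolded split_beta fst_conv snd_conv]) auto
  qed
  from integral_continuous_on_param[OF this] show ?thesis
    by (simp add: contour_integral_integral vector_derivative_circlepath)
qed

lemma Leibniz_contour_integral_circlepath:
  fixes f :: "complex \<Rightarrow> complex \<Rightarrow> complex"
  assumes f: "\<And>x w. x \<in> U \<Longrightarrow> w \<in> sphere c r \<Longrightarrow>
                ((\<lambda>x. f x w) has_field_derivative f' x w) (at x within U)"
    and int: "\<And>x. x \<in> U \<Longrightarrow> continuous_on (sphere c r) (f x)"
    and cont: "continuous_on (U \<times> sphere c r) (\<lambda>(x, w). f' x w)"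
    and "0 \<le> r" "x0 \<in> U" "convex U"
  shows "((\<lambda>x. contour_integral (circlepath c r) (f x)) has_field_derivative
            contour_integral (circlepath c r) (f' x0)) (at x0 within U)"
proof -
  have circ: "circlepath c r s \<in> sphere c r" if "s \<in> cbox 0 1" for s
    using that \<open>0 \<le> r\<close> path_image_circlepath[of c r] by (auto simp: path_image_def)
  have contc: "continuous_on (cbox 0 1) (circlepath c r)"
    unfolding circlepath by (intro continuous_intros)
  define k where "k s = 2 * pi * \<i> * r * exp (2 * of_real pi * \<i> * of_real s)" for s :: real
  have "((\<lambda>x. integral (cbox 0 1) (\<lambda>s. f x (circlepath c r s) * k s)) has_field_derivative
         integral (cbox 0 1) (\<lambda>s. f' x0 (circlepath c r s) * k s)) (at x0 within U)"
  proof (rule leibniz_rule_field_derivative)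
    show "((\<lambda>x. f x (circlepath c r s) * k s) has_field_derivative f' x (circlepath c r s) * k s)
            (at x within U)" if "x \<in> U" "s \<in> cbox 0 1" for x s
      by (intro DERIV_cmult_right f that circ)
    show "(\<lambda>s. f x (circlepath c r s) * k s) integrable_on cbox 0 1" if "x \<in> U" for x
    proof (intro integrable_continuous continuous_on_mult)
      show "continuous_on (cbox 0 1) (\<lambda>s. f x (circlepath c r s))"
        by (rule continuous_on_compose2[OF int[OF that] contc]) (use circ in blast)
    qed (auto simp: k_def intro!: continuous_intros)
    have "continuous_on (U \<times> cbox 0 1) (\<lambda>p. (fst p, circlepath c r (snd p)))"
      unfolding circlepath by (intro continuous_intros)
    then have "continuous_on (U \<times> cbox 0 1) (\<lambda>p. f' (fst p) (circlepath c r (snd p)))"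
      using circ
      by (intro continuous_on_compose2[OF cont, of _ "\<lambda>p. (fst p, circlepath c r (snd p))",
            unfolded split_beta fst_conv snd_conv]) auto
    then show "continuous_on (U \<times> cbox 0 1) (\<lambda>(x, s). f' x (circlepath c r s) * k s)"
      unfolding split_beta k_def by (intro continuous_intros)
  qed fact+
  then show ?thesis
    by (simp add: contour_integral_integral vector_derivative_circlepath k_def)
qed

text \<open>Inside the unit disc \<open>S\<close> is only real differentiable in \<open>z\<close>.
  The derivative is therefore a real-linear map, recorded by its two Wirtinger coefficients.\<close>

lemma Leibniz_contour_integral_circlepath_wirtinger:
  fixes g gz gzb :: "complex \<Rightarrow> complex \<Rightarrow> complex"
  assumes g: "\<And>z x. x \<in> sphere c r \<Longrightarrow>
                ((\<lambda>z. g z x) has_derivative (\<lambda>h. gz z x * h + gzb z x * cnj h)) (at z)"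
    and int: "\<And>z. continuous_on (sphere c r) (g z)"
    and cont: "continuous_on (UNIV \<times> sphere c r) (\<lambda>(z, x). gz z x)"
              "continuous_on (UNIV \<times> sphere c r) (\<lambda>(z, x). gzb z x)"
    and "0 \<le> r"
  shows "((\<lambda>z. contour_integral (circlepath c r) (g z)) has_derivative
            (\<lambda>h. contour_integral (circlepath c r) (gz z) * h
                 + contour_integral (circlepath c r) (gzb z) * cnj h)) (at z)"
proof -
  have circ: "circlepath c r s \<in> sphere c r" if "s \<in> cbox 0 1" for s
    using that \<open>0 \<le> r\<close> path_image_circlepath[of c r] by (auto simp: path_image_def)
  have contc: "continuous_on (cbox 0 1) (circlepath c r)"
    unfolding circlepath by (intro continuous_intros)
  define k where "k s = 2 * pi * \<i> * r * exp (2 * of_real pi * \<i> * of_real s)" for s :: real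
  \<comment> \<open>The rule for Frechet derivatives under the integral sign needs the derivative as
    a bounded linear map depending continuously on all variables. \<open>D a b\<close> packages
    \<open>h -> a * h + b * cnj h\<close> in that form.\<close>
  define D :: "complex \<Rightarrow> complex \<Rightarrow> complex \<Rightarrow>\<^sub>L complex" where
    "D a b = blinfun_mult_right a + (blinfun_mult_right b o\<^sub>L Blinfun cnj)" for a b
  have D: "blinfun_apply (D a b) = (\<lambda>h. a * h + b * cnj h)" for a b
    by (auto simp: fun_eq_iff D_def blinfun.add_left bounded_linear_Blinfun_apply[OF bounded_linear_cnj])
  have contk: "continuous_on A (\<lambda>p. F (fst p) (circlepath c r (snd p)) * k (snd p))"
    if "continuous_on (UNIV \<times> sphere c r) (\<lambda>(z, x). F z x)" "A \<subseteq> UNIV \<times> cbox 0 1" for F A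
  proof (intro continuous_on_mult)
    have "continuous_on A (\<lambda>p. (fst p, circlepath c r (snd p)))"
      unfolding circlepath by (intro continuous_intros)
    then show "continuous_on A (\<lambda>p. F (fst p) (circlepath c r (snd p)))"
      using circ that(2)
      by (intro continuous_on_compose2[OF that(1), of _ "\<lambda>p. (fst p, circlepath c r (snd p))",
            unfolded split_beta fst_conv snd_conv]) auto
  qed (auto simp: k_def intro!: continuous_intros)
  have contk1: "continuous_on (cbox 0 1) (\<lambda>s. F (circlepath c r s) * k s)"
    if "continuous_on (sphere c r) F" for F
  proof (intro continuous_on_mult)
    show "continuous_on (cbox 0 1) (\<lambda>s. F (circlepath c r s))"
      by (rule continuous_on_compose2[OF that contc]) (use circ in blast)
  qed (auto simp: k_def intro!: continuous_intros)
  have slice: "continuous_on (sphere c r) (F z)"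
    if "continuous_on (UNIV \<times> sphere c r) (\<lambda>(z, x). F z x)" for F :: "complex \<Rightarrow> complex \<Rightarrow> complex"
    by (rule continuous_on_compose2[OF that, of _ "\<lambda>x. (z, x)", simplified])
       (auto intro!: continuous_intros)
  let ?DD = "\<lambda>z s. D (gz z (circlepath c r s) * k s) (gzb z (circlepath c r s) * k s)"
  have contD: "continuous_on (UNIV \<times> cbox 0 1) (\<lambda>(z, s). ?DD z s)"
    unfolding D_def split_beta
    by (intro continuous_on_add bounded_linear.continuous_on[OF bounded_linear_blinfun_mult_right]
          bounded_bilinear.continuous_on[OF bounded_bilinear_blinfun_compose] contk cont
          continuous_on_const order_refl)
  have "((\<lambda>z. integral (cbox 0 1) (\<lambda>s. g z (circlepath c r s) * k s)) has_derivative
         blinfun_apply (integral (cbox 0 1) (?DD z))) (at z within UNIV)"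
  proof (rule leibniz_rule)
    show "((\<lambda>z. g z (circlepath c r s) * k s) has_derivative blinfun_apply (?DD z s))
            (at z within UNIV)" if "z \<in> UNIV" "s \<in> cbox 0 1" for z s
      unfolding D by (rule derivative_eq_intros g[OF circ[OF that(2)]] refl)+ (auto simp: algebra_simps)
    show "(\<lambda>s. g z (circlepath c r s) * k s) integrable_on cbox 0 1" for z
      by (intro integrable_continuous contk1 int)
    show "continuous_on (UNIV \<times> cbox 0 1) (\<lambda>(z, s). ?DD z s)"
      by (rule contD)
  qed auto
  moreover have "blinfun_apply (integral (cbox 0 1) (?DD z)) =
      (\<lambda>h. contour_integral (circlepath c r) (gz z) * h
           + contour_integral (circlepath c r) (gzb z) * cnj h)"
  proof
    fix h
    have intD: "?DD z integrable_on cbox 0 1"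
      by (intro integrable_continuous
          continuous_on_compose2[OF contD, of _ "\<lambda>s. (z, s)", simplified split_beta fst_conv snd_conv])
         (auto intro!: continuous_intros)
    have "blinfun_apply (integral (cbox 0 1) (?DD z)) h = integral (cbox 0 1) (\<lambda>s. blinfun_apply (?DD z s) h)"
      by (rule blinfun_apply_integral[OF intD])
    also have "\<dots> = integral (cbox 0 1) (\<lambda>s. gz z (circlepath c r s) * k s * h)
                   + integral (cbox 0 1) (\<lambda>s. gzb z (circlepath c r s) * k s * cnj h)"
      unfolding D
      by (intro integral_add integrable_continuous continuous_on_mult_right contk1 slice cont)
    also have "\<dots> = integral (cbox 0 1) (\<lambda>s. gz z (circlepath c r s) * k s) * h
                   + integral (cbox 0 1) (\<lambda>s. gzb z (circlepath c r s) * k s) * cnj h"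
      by simp
    finally show "blinfun_apply (integral (cbox 0 1) (?DD z)) h =
        contour_integral (circlepath c r) (gz z) * h + contour_integral (circlepath c r) (gzb z) * cnj h"
      by (simp add: contour_integral_integral vector_derivative_circlepath k_def)
  qed
  ultimately have "((\<lambda>z. integral (cbox 0 1) (\<lambda>s. g z (circlepath c r s) * k s)) has_derivative
      (\<lambda>h. contour_integral (circlepath c r) (gz z) * h
           + contour_integral (circlepath c r) (gzb z) * cnj h)) (at z)"
    by simp
  then show ?thesis
    by (simp add: contour_integral_integral[of _ "g _"] vector_derivative_circlepath k_def)
qed

text \<open>Cauchy's formula turns the derivative in \<open>x\<close> into a circle integral of
  values of \<open>g\<close>, so joint continuity of \<open>g\<close> passes to the derivative.
  Nothing beyond continuity in \<open>w\<close> is involved.\<close>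

lemma deriv_holomorphic_parameter:
  fixes g :: "'a::topological_space \<Rightarrow> complex \<Rightarrow> complex"
  assumes cont: "continuous_on (U \<times> cball x0 R) (\<lambda>(w, x). g w x)"
    and hol: "\<And>w. w \<in> U \<Longrightarrow> g w holomorphic_on ball x0 R"
  shows deriv_eq_contour_integral_parameter:
      "\<And>w x. w \<in> U \<Longrightarrow> x \<in> ball x0 R \<Longrightarrow>
         deriv (g w) x = 1 / (2 * of_real pi * \<i>) *
           contour_integral (circlepath x0 R) (\<lambda>y. g w y / (y - x)\<^sup>2)"
    and continuous_on_deriv_parameter:
      "continuous_on (U \<times> ball x0 R) (\<lambda>(w, x). deriv (g w) x)"
proof -
  have contw: "continuous_on (cball x0 R) (g w)" if "w \<in> U" for w
    by (rule continuous_on_compose2[OF cont, of _ "\<lambda>x. (w, x)", simplified])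
       (auto intro!: continuous_intros that)
  show eq: "deriv (g w) x = 1 / (2 * of_real pi * \<i>) *
           contour_integral (circlepath x0 R) (\<lambda>y. g w y / (y - x)\<^sup>2)"
    if "w \<in> U" "x \<in> ball x0 R" for w x
    by (rule DERIV_imp_deriv, rule Cauchy_derivative_integral_circlepath(2)[OF contw hol])
       (use that in auto)
  show "continuous_on (U \<times> ball x0 R) (\<lambda>(w, x). deriv (g w) x)"
  proof (cases "R > 0")
    case True
    have "continuous_on (U \<times> ball x0 R)
            (\<lambda>p. contour_integral (circlepath x0 R) (\<lambda>y. g (fst p) y / (y - snd p)\<^sup>2))"
    proof (rule continuous_on_contour_integral_circlepath)
      have *: "continuous_on ((U \<times> ball x0 R) \<times> sphere x0 R) (\<lambda>p. g (fst (fst p)) (snd p))"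
        by (rule continuous_on_compose2[OF cont, of _ "\<lambda>p. (fst (fst p), snd p)",
              unfolded split_beta fst_conv snd_conv]) (auto intro!: continuous_intros)
      show "continuous_on ((U \<times> ball x0 R) \<times> sphere x0 R)
              (\<lambda>(p, y). g (fst p) y / (y - snd p)\<^sup>2)"
        unfolding split_beta by (intro continuous_intros *) auto
    qed (use True in auto)
    then have "continuous_on (U \<times> ball x0 R) (\<lambda>p. 1 / (2 * of_real pi * \<i>) *
                 contour_integral (circlepath x0 R) (\<lambda>y. g (fst p) y / (y - snd p)\<^sup>2))"
      by (intro continuous_intros)
    then show ?thesis
      by (rule continuous_on_cong[THEN iffD1, rotated 2]) (auto simp: eq)
  next
    case False
    then have "U \<times> ball x0 R = {}" by simp
    then show ?thesis by (simp only: continuous_on_empty)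
  qed
qed

text \<open>Holomorphy in the parameter supplies, through Cauchy's formula, the joint continuity of
  the derivative that the Leibniz rule asks for.\<close>

lemma contour_integral_holomorphic_parameter:
  fixes g :: "complex \<Rightarrow> complex \<Rightarrow> complex"
  assumes cont: "continuous_on (sphere c r \<times> cball x0 R) (\<lambda>(w, x). g w x)"
    and hol: "\<And>w. w \<in> sphere c r \<Longrightarrow> g w holomorphic_on ball x0 R"
    and "0 \<le> r" and x: "x \<in> ball x0 R"
  shows "((\<lambda>x. contour_integral (circlepath c r) (\<lambda>w. g w x)) has_field_derivative
            contour_integral (circlepath c r) (\<lambda>w. deriv (g w) x)) (at x)"
proof -
  have "((\<lambda>x. contour_integral (circlepath c r) (\<lambda>w. g w x)) has_field_derivative
            contour_integral (circlepath c r) (\<lambda>w. deriv (g w) x)) (at x within ball x0 R)"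
  proof (rule Leibniz_contour_integral_circlepath)
    show "(g w has_field_derivative deriv (g w) x) (at x within ball x0 R)"
      if "x \<in> ball x0 R" "w \<in> sphere c r" for x w
      using holomorphic_derivI[OF hol[OF that(2)] _ that(1)] by (simp add: at_within_open[OF that(1)])
    show "continuous_on (sphere c r) (\<lambda>w. g w x)" if "x \<in> ball x0 R" for x
      by (rule continuous_on_compose2[OF cont, of _ "\<lambda>w. (w, x)", simplified])
         (use that in \<open>auto intro!: continuous_intros\<close>)
    show "continuous_on (ball x0 R \<times> sphere c r) (\<lambda>(x, w). deriv (g w) x)"
      unfolding split_beta
      by (rule continuous_on_compose2[OF continuous_on_deriv_parameter[OF cont hol],
            of _ "\<lambda>p. (snd p, fst p)", unfolded split_beta fst_conv snd_conv])
         (auto intro!: continuous_intros)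
  qed (use assms in auto)
  then show ?thesis using x by (simp add: at_within_open[OF x])
qed

text \<open>By Cauchy's formula the derivative in \<open>b\<close> at \<open>b0\<close> is a circle
  integral over \<open>b\<close>, which can be differentiated in \<open>a\<close> under the integral
  sign.\<close>

lemma mixed_deriv_aux:
  fixes g :: "complex \<Rightarrow> complex \<Rightarrow> complex"
  assumes cont: "continuous_on (cball a0 r \<times> cball b0 R) (\<lambda>(a, b). g a b)"
    and hola: "\<And>b. b \<in> cball b0 R \<Longrightarrow> (\<lambda>a. g a b) holomorphic_on ball a0 r"
    and holb: "\<And>a. a \<in> cball a0 r \<Longrightarrow> g a holomorphic_on ball b0 R"
    and "0 < R" and a: "a \<in> ball a0 r"
  shows "((\<lambda>a. deriv (g a) b0) has_field_derivative
            1 / (2 * of_real pi * \<i>) * contour_integral (circlepath b0 R)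
              (\<lambda>b. deriv (\<lambda>a. g a b) a / (b - b0)\<^sup>2)) (at a)"
proof -
  let ?K = "1 / (2 * of_real pi * \<i>) :: complex"
  have contg: "continuous_on (sphere b0 R \<times> cball a0 r) (\<lambda>p. g (snd p) (fst p))"
    by (rule continuous_on_compose2[OF cont, of _ "\<lambda>p. (snd p, fst p)",
              unfolded split_beta fst_conv snd_conv]) (auto intro!: continuous_intros)
  have "((\<lambda>a. contour_integral (circlepath b0 R) (\<lambda>b. g a b / (b - b0)\<^sup>2)) has_field_derivative
          contour_integral (circlepath b0 R) (\<lambda>b. deriv (\<lambda>a. g a b / (b - b0)\<^sup>2) a)) (at a)"
  proof (rule contour_integral_holomorphic_parameter)
    show "continuous_on (sphere b0 R \<times> cball a0 r) (\<lambda>(b, a). g a b / (b - b0)\<^sup>2)"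
      unfolding split_beta using \<open>0 < R\<close> by (intro continuous_intros contg) auto
    show "(\<lambda>a. g a b / (b - b0)\<^sup>2) holomorphic_on ball a0 r" if "b \<in> sphere b0 R" for b
      using that \<open>0 < R\<close> by (intro holomorphic_intros hola) auto
  qed (use assms in auto)
  moreover have "contour_integral (circlepath b0 R) (\<lambda>b. deriv (\<lambda>a. g a b / (b - b0)\<^sup>2) a) =
     contour_integral (circlepath b0 R) (\<lambda>b. deriv (\<lambda>a. g a b) a / (b - b0)\<^sup>2)"
  proof (rule contour_integral_cong)
    fix b assume "b \<in> path_image (circlepath b0 R)"
    then have "(\<lambda>a. g a b) field_differentiable at a"
      using \<open>0 < R\<close> a hola[of b] by (auto intro: holomorphic_on_imp_differentiable_at)
    then show "deriv (\<lambda>a. g a b / (b - b0)\<^sup>2) a = deriv (\<lambda>a. g a b) a / (b - b0)\<^sup>2"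
      by (rule deriv_cdivide_right)
  qed auto
  ultimately have "((\<lambda>a. ?K * contour_integral (circlepath b0 R) (\<lambda>b. g a b / (b - b0)\<^sup>2)) has_field_derivative
      ?K * contour_integral (circlepath b0 R) (\<lambda>b. deriv (\<lambda>a. g a b) a / (b - b0)\<^sup>2)) (at a)"
    by (intro DERIV_cmult) simp
  then show ?thesis
    by (rule has_field_derivative_transform_within_open[OF _ open_ball a])
       (subst deriv_eq_contour_integral_parameter[OF cont holb]; use assms in auto)
qed

text \<open>The derivative in \<open>a\<close> of the \<open>b\<close>-derivative is, by the
  preceding lemma, a circle integral over \<open>b\<close> of the \<open>a\<close>-derivative. The
  same integral is Cauchy's formula for the opposite order, once the \<open>a\<close>-derivative is
  known to be holomorphic in \<open>b\<close>.\<close>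

lemma mixed_deriv_commute:
  fixes g :: "complex \<Rightarrow> complex \<Rightarrow> complex"
  assumes cont: "continuous_on (cball a0 r \<times> cball b0 R) (\<lambda>(a, b). g a b)"
    and hola: "\<And>b. b \<in> cball b0 R \<Longrightarrow> (\<lambda>a. g a b) holomorphic_on ball a0 r"
    and holb: "\<And>a. a \<in> cball a0 r \<Longrightarrow> g a holomorphic_on ball b0 R"
    and "0 < r" "0 < R"
  obtains d where "((\<lambda>a. deriv (g a) b0) has_field_derivative d) (at a0)"
    and "((\<lambda>b. deriv (\<lambda>a. g a b) a0) has_field_derivative d) (at b0)"
proof -
  let ?G = "\<lambda>b. deriv (\<lambda>a. g a b) a0"
  have cont': "continuous_on (cball b0 R \<times> cball a0 r) (\<lambda>(b, a). g a b)"
    unfolding split_beta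
    by (rule continuous_on_compose2[OF cont, of _ "\<lambda>p. (snd p, fst p)",
              unfolded split_beta fst_conv snd_conv])
       (auto intro!: continuous_intros)
  \<comment> \<open>This is the preceding lemma with the two variables exchanged.\<close>
  have "?G holomorphic_on ball b0 R"
    unfolding holomorphic_on_def field_differentiable_def
    using mixed_deriv_aux[OF cont' holb hola \<open>0 < r\<close>] has_field_derivative_at_within by blast
  moreover have "continuous_on (cball b0 R) ?G"
    by (rule continuous_on_compose2[OF continuous_on_deriv_parameter[OF cont' hola],
            of _ "\<lambda>b. (b, a0)", unfolded split_beta fst_conv snd_conv])
       (use \<open>0 < r\<close> in \<open>auto intro!: continuous_intros\<close>)
  ultimately have "(?G has_field_derivative
      1 / (2 * of_real pi * \<i>) * contour_integral (circlepath b0 R) (\<lambda>b. ?G b / (b - b0)\<^sup>2)) (at b0)"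
    using \<open>0 < R\<close> by (intro Cauchy_derivative_integral_circlepath) auto
  with mixed_deriv_aux[OF cont hola holb \<open>0 < R\<close>, of a0] show ?thesis
    using \<open>0 < r\<close> that by auto
qed

section \<open>Wirtinger derivatives of functions with a holomorphic parameter\<close>

lemma wirtinger_coeffs_unique:
  fixes a b a' b' :: complex
  assumes "(f has_derivative (\<lambda>h. a * h + b * cnj h)) (at z)"
    and "(f has_derivative (\<lambda>h. a' * h + b' * cnj h)) (at z)"
  shows "a = a'" "b = b'"
proof -
  have *: "a * h + b * cnj h = a' * h + b' * cnj h" for h
    using has_derivative_unique[OF assms] by meson
  from *[of 1] *[of \<i>] have "a + b = a' + b'" "(a - b) * \<i> = (a' - b') * \<i>"
    by (simp_all add: algebra_simps)
  then have "a + b = a' + b'" "a - b = a' - b'" by simp_all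
  then show "a = a'" "b = b'"
    by (metis add_diff_cancel add_diff_eq diff_add_cancel mult_2 mult_cancel_left add.commute
        diff_diff_eq2 zero_neq_numeral)+
qed

text \<open>
  Cauchy's formula in the parameter expresses \<open>g\<close> by its values on a circle of parameters; the two
  Wirtinger derivatives in \<open>z\<close> are then taken under the integral sign.
\<close>
lemma wirtinger_holomorphic_parameter:
  fixes g gz gzb :: "complex \<Rightarrow> complex \<Rightarrow> complex"
  assumes g: "\<And>z x. x \<in> cball x0 R \<Longrightarrow>
                ((\<lambda>z. g z x) has_derivative (\<lambda>h. gz z x * h + gzb z x * cnj h)) (at z)"
    and contx: "\<And>z. continuous_on (cball x0 R) (g z)"
    and hol: "\<And>z. g z holomorphic_on ball x0 R"
    and cont: "continuous_on (UNIV \<times> cball x0 R) (\<lambda>(z, x). gz z x)"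
              "continuous_on (UNIV \<times> cball x0 R) (\<lambda>(z, x). gzb z x)"
    and "0 < R"
  shows "gz z field_differentiable (at x0)"
    and "((\<lambda>z. deriv (g z) x0) has_derivative
            (\<lambda>h. deriv (gz z) x0 * h + deriv (gzb z) x0 * cnj h)) (at z)"
proof -
  let ?K = "1 / (2 * of_real pi * \<i>) :: complex"
  let ?I = "\<lambda>F. contour_integral (circlepath x0 R) F"
  have ne: "y \<noteq> x" if "y \<in> sphere x0 R" "x \<in> ball x0 R" for x y
    using that by auto
  have conts: "continuous_on (UNIV \<times> sphere x0 R) (\<lambda>(z, y). F z y / (y - x) ^ k)"
    if "continuous_on (UNIV \<times> cball x0 R) (\<lambda>(z, x). F z x)" "x \<in> ball x0 R" for F x k
    unfolding split_beta
    by (intro continuous_intros continuous_on_subset[OF that(1)[unfolded split_beta]])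
       (use ne[OF _ that(2)] in auto)
  have cont1: "continuous_on (sphere x0 R) (F z)"
    if "continuous_on (UNIV \<times> cball x0 R) (\<lambda>(z, x). F z x)"
    for F :: "complex \<Rightarrow> complex \<Rightarrow> complex" and z
    by (rule continuous_on_compose2[OF that, of _ "\<lambda>x. (z, x)", simplified])
       (auto intro!: continuous_intros)
  \<comment> \<open>The exponent stays free: \<open>k = 1\<close> serves Cauchy's formula for
    \<open>g\<close>, \<open>k = 2\<close> the formula for its derivative in
    \<open>x\<close>.\<close>
  have Leib: "((\<lambda>z. ?K * ?I (\<lambda>y. g z y / (y - x) ^ k)) has_derivative
      (\<lambda>h. (?K * ?I (\<lambda>y. gz z y / (y - x) ^ k)) * h + (?K * ?I (\<lambda>y. gzb z y / (y - x) ^ k)) * cnj h)) (at z)"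
    if x: "x \<in> ball x0 R" for x k z
  proof -
    have "((\<lambda>z. ?I (\<lambda>y. g z y / (y - x) ^ k)) has_derivative
      (\<lambda>h. ?I (\<lambda>y. gz z y / (y - x) ^ k) * h + ?I (\<lambda>y. gzb z y / (y - x) ^ k) * cnj h)) (at z)"
    proof (rule Leibniz_contour_integral_circlepath_wirtinger)
      show "((\<lambda>z. g z y / (y - x) ^ k) has_derivative
              (\<lambda>h. gz z y / (y - x) ^ k * h + gzb z y / (y - x) ^ k * cnj h)) (at z)"
        if "y \<in> sphere x0 R" for y z
      proof -
        have "((\<lambda>z. g z y / (y - x) ^ k) has_derivative
                 (\<lambda>h. (gz z y * h + gzb z y * cnj h) / (y - x) ^ k)) (at z)"
          by (rule bounded_linear.has_derivative[OF bounded_linear_divide], rule g) (use that in auto)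
        then show ?thesis by (simp add: add_divide_distrib)
      qed
      show "continuous_on (sphere x0 R) (\<lambda>y. g z y / (y - x) ^ k)" for z
        by (intro continuous_intros continuous_on_subset[OF contx]) (use ne[OF _ x] in auto)
    qed (use \<open>0 < R\<close> x in \<open>auto intro!: conts cont\<close>)
    from has_derivative_mult_right[OF this, of ?K] show ?thesis
      by (simp add: algebra_simps)
  qed
  have g_eq: "g z x = ?K * ?I (\<lambda>y. g z y / (y - x) ^ 1)" if "x \<in> ball x0 R" for z x
    using contour_integral_unique[OF Cauchy_integral_circlepath[OF contx[of z] hol[of z], of x]] that
    by (simp add: dist_norm norm_minus_commute)
  have der: "((\<lambda>z. g z x) has_derivative
      (\<lambda>h. (?K * ?I (\<lambda>y. gz z y / (y - x) ^ 1)) * h + (?K * ?I (\<lambda>y. gzb z y / (y - x) ^ 1)) * cnj h)) (at z)"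
    if x: "x \<in> ball x0 R" for x z
    unfolding g_eq[OF x] by (rule Leib[OF x])
  \<comment> \<open>Only continuity of \<open>gz\<close> and \<open>gzb\<close> in \<open>x\<close>
    is assumed. Differentiating Cauchy's formula for \<open>g\<close> in \<open>z\<close> and
    comparing Wirtinger coefficients shows that both satisfy the same formula, which makes them
    differentiable in \<open>x\<close>.\<close>
  have rep: "gz z x = ?K * ?I (\<lambda>y. gz z y / (y - x) ^ 1)" "gzb z x = ?K * ?I (\<lambda>y. gzb z y / (y - x) ^ 1)"
    if x: "x \<in> ball x0 R" for x z
    using wirtinger_coeffs_unique[OF g der[OF x]] x by auto
  have next_der: "(F has_field_derivative ?K * ?I (\<lambda>y. F y / (y - x0) ^ 2)) (at x0)"
    if F: "continuous_on (sphere x0 R) F"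
      and rep: "\<And>x. x \<in> ball x0 R \<Longrightarrow> F x = ?K * ?I (\<lambda>y. F y / (y - x) ^ 1)" for F
  proof -
    have x0: "x0 \<in> ball x0 R" using \<open>0 < R\<close> by simp
    have "((\<lambda>x. ?I (\<lambda>y. F y / (y - x) ^ 1)) has_field_derivative
             of_nat 1 * ?I (\<lambda>y. F y / (y - x0) ^ Suc 1)) (at x0)"
    proof (rule Cauchy_next_derivative_circlepath(2))
      show "continuous_on (path_image (circlepath x0 R)) F"
        using F \<open>0 < R\<close> by simp
      show "((\<lambda>u. F u / (u - w) ^ 1) has_contour_integral ?I (\<lambda>y. F y / (y - w) ^ 1)) (circlepath x0 R)"
        if "w \<in> ball x0 R" for w
      proof (intro has_contour_integral_integral contour_integrable_continuous_circlepath)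
        show "continuous_on (path_image (circlepath x0 R)) (\<lambda>u. F u / (u - w) ^ 1)"
          using F \<open>0 < R\<close> that by (auto intro!: continuous_intros)
      qed
    qed (use x0 in auto)
    from DERIV_cmult[OF this, of ?K]
    have "((\<lambda>x. ?K * ?I (\<lambda>y. F y / (y - x) ^ 1)) has_field_derivative
            ?K * ?I (\<lambda>y. F y / (y - x0) ^ 2)) (at x0)"
      by (simp add: numeral_2_eq_2)
    then show ?thesis
      by (rule has_field_derivative_transform_within_open[OF _ open_ball x0]) (simp only: rep)
  qed
  have dz: "(gz z has_field_derivative ?K * ?I (\<lambda>y. gz z y / (y - x0) ^ 2)) (at x0)"
    and dzb: "(gzb z has_field_derivative ?K * ?I (\<lambda>y. gzb z y / (y - x0) ^ 2)) (at x0)" for z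
    by (rule next_der; intro cont1 cont rep; assumption)+
  show "gz z field_differentiable (at x0)"
    using dz by (auto simp: field_differentiable_def)
  have "deriv (g z) x0 = ?K * ?I (\<lambda>y. g z y / (y - x0) ^ 2)" for z
    by (rule DERIV_imp_deriv, rule Cauchy_derivative_integral_circlepath(2)[OF contx hol])
       (use \<open>0 < R\<close> in auto)
  then show "((\<lambda>z. deriv (g z) x0) has_derivative
            (\<lambda>h. deriv (gz z) x0 * h + deriv (gzb z) x0 * cnj h)) (at z)"
    using Leib[of x0 2 z] \<open>0 < R\<close> by (simp add: DERIV_imp_deriv[OF dz] DERIV_imp_deriv[OF dzb])
qed

section \<open>Derivatives in the times\<close>

lemma continuous_on_fun_upd2:
  fixes t :: times
  shows "continuous_on UNIV (\<lambda>p. t(m := fst p, n := snd p))"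
proof (rule continuous_on_coordinatewise_then_product)
  fix i
  show "continuous_on UNIV (\<lambda>p. (t(m := fst p, n := snd p)) i)"
    by (cases "i = m"; cases "i = n") (auto intro!: continuous_intros)
qed

lemma fun_upd2_in_slice: "t(m := a, n := b) \<in> slice t (Suc (max m n))"
  by (auto simp: slice_def)

text \<open>Moving the times \<open>m\<close> and \<open>n\<close> stays within the slice of length
  \<open>Suc (max m n)\<close>, where \<open>T\<close> is relatively open. The case
  \<open>m = n\<close> is included; there the second update overrides the first.\<close>

lemma finitely_open_fun_upd2:
  assumes "finitely_open T" "t \<in> T"
  obtains R where "R > 0" "\<And>a b. a \<in> cball (t m) R \<Longrightarrow> b \<in> cball (t n) R \<Longrightarrow> t(m := a, n := b) \<in> T"
proof -
  let ?k = "Suc (max m n)" and ?G = "\<lambda>p. t(m := fst p, n := snd p)"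
  from assms obtain V where V: "open V" "T \<inter> slice t ?k = slice t ?k \<inter> V"
    unfolding finitely_open_def by (metis openin_open)
  have "open (?G -` V)"
    using continuous_on_fun_upd2 V(1) by (auto simp: continuous_on_open_vimage)
  moreover have "(t m, t n) \<in> ?G -` V"
    using V(2) assms(2) by (auto simp: slice_def)
  ultimately obtain A B where "open A" "open B" "(t m, t n) \<in> A \<times> B" "A \<times> B \<subseteq> ?G -` V"
    by (rule open_prod_elim)
  then have AB: "open A" "open B" "t m \<in> A" "t n \<in> B" "A \<times> B \<subseteq> ?G -` V"
    by auto
  from AB obtain r1 where r1: "r1 > 0" "cball (t m) r1 \<subseteq> A" by (meson open_contains_cball)
  from AB obtain r2 where r2: "r2 > 0" "cball (t n) r2 \<subseteq> B" by (meson open_contains_cball)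
  show ?thesis
  proof (rule that[of "min r1 r2"])
    fix a b assume "a \<in> cball (t m) (min r1 r2)" "b \<in> cball (t n) (min r1 r2)"
    then have "(a, b) \<in> A \<times> B" using r1 r2 by auto
    then have "t(m := a, n := b) \<in> V" using AB(5) by auto
    then show "t(m := a, n := b) \<in> T" using V(2) fun_upd2_in_slice by blast
  qed (use r1 r2 in auto)
qed

lemma finitely_open_fun_upd:
  assumes "finitely_open T" "t \<in> T"
  obtains R where "R > 0" "\<And>a. a \<in> cball (t n) R \<Longrightarrow> t(n := a) \<in> T"
  using finitely_open_fun_upd2[OF assms, of n n] by (metis fun_upd_upd centre_in_cball less_imp_le)

lemma eventually_fun_upd_in:
  assumes "finitely_open T" "t \<in> T"
  shows "\<forall>\<^sub>F s in nhds (t n). t(n := s) \<in> T"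
proof -
  from finitely_open_fun_upd[OF assms] obtain R
    where "R > 0" "\<And>a. a \<in> cball (t n) R \<Longrightarrow> t(n := a) \<in> T" by blast
  then show ?thesis
    by (intro eventually_nhds_in_open[of "ball (t n) R", THEN eventually_mono]) auto
qed

text \<open>Functions of the times are controlled on \<open>T\<close> only; this suffices because
  \<open>T\<close> contains a disc around \<open>t\<close> in every single time direction.\<close>

lemma pd_cong:
  assumes "finitely_open T" "t \<in> T" "\<And>s. s \<in> T \<Longrightarrow> f s = g s"
  shows "pd n f t = pd n g t"
  unfolding pd_def
  by (intro deriv_cong_ev eventually_mono[OF eventually_fun_upd_in[OF assms(1,2)]] assms(3)) auto

lemma time_holomorphic_on_imp_holomorphic:
  assumes "time_holomorphic_on T f" "\<And>x. x \<in> U \<Longrightarrow> t(n := x) \<in> T"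
  shows "(\<lambda>x. f (t(n := x))) holomorphic_on U"
  unfolding holomorphic_on_def
proof
  fix x assume "x \<in> U"
  with assms have "(\<lambda>s. f ((t(n := x))(n := s))) field_differentiable (at ((t(n := x)) n))"
    unfolding time_holomorphic_on_def by blast
  then show "(\<lambda>x. f (t(n := x))) field_differentiable (at x within U)"
    by (simp add: field_differentiable_at_within)
qed

lemma time_holomorphic_on_imp_continuous2:
  assumes "time_holomorphic_on T f" "t \<in> T"
    "\<And>a b. a \<in> A \<Longrightarrow> b \<in> B \<Longrightarrow> t(m := a, n := b) \<in> T"
  shows "continuous_on (A \<times> B) (\<lambda>(a, b). f (t(m := a, n := b)))"
proof -
  have "continuous_on (T \<inter> slice t (Suc (max m n))) f"
    using assms by (auto simp: time_holomorphic_on_def)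
  then show ?thesis
    unfolding split_beta
    by (rule continuous_on_compose2[OF _ continuous_on_subset[OF continuous_on_fun_upd2]])
       (use assms fun_upd2_in_slice in auto)
qed

text \<open>For \<open>m = n\<close> only the differentiability of the derivative of a holomorphic
  function is at stake. For distinct times, \<open>f\<close> restricted to a bidisc is continuous
  and separately holomorphic, and the mixed derivatives agree by Cauchy's formula.\<close>

lemma pd_differentiable_commute:
  assumes f: "time_holomorphic_on T f" and T: "finitely_open T" "t \<in> T"
  shows pd_field_differentiable: "(\<lambda>s. pd n f (t(m := s))) field_differentiable (at (t m))"
    and pd_commute: "pd m (pd n f) t = pd n (pd m f) t"
proof -
  have "(\<lambda>s. pd n f (t(m := s))) field_differentiable (at (t m)) \<and> pd m (pd n f) t = pd n (pd m f) t"
  proof (cases "m = n")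
    case True
    from finitely_open_fun_upd[OF T] obtain R
      where R: "R > 0" "\<And>a. a \<in> cball (t n) R \<Longrightarrow> t(n := a) \<in> T" by blast
    have "(\<lambda>x. f (t(n := x))) holomorphic_on ball (t n) R"
      by (rule time_holomorphic_on_imp_holomorphic[OF f]) (use R in auto)
    then have "deriv (\<lambda>x. f (t(n := x))) field_differentiable (at (t n))"
      using R(1) by (meson centre_in_ball holomorphic_deriv holomorphic_on_imp_differentiable_at open_ball)
    then show ?thesis using True by (simp add: pd_def)
  next
    case False
    obtain R where R: "R > 0"
        "\<And>a b. a \<in> cball (t m) R \<Longrightarrow> b \<in> cball (t n) R \<Longrightarrow> t(m := a, n := b) \<in> T"
      using finitely_open_fun_upd2[OF T, of m n] by blast
    let ?g = "\<lambda>a b. f (t(m := a, n := b))"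
    obtain d where d: "((\<lambda>a. deriv (?g a) (t n)) has_field_derivative d) (at (t m))"
        "((\<lambda>b. deriv (\<lambda>a. ?g a b) (t m)) has_field_derivative d) (at (t n))"
    proof (rule mixed_deriv_commute)
      show "continuous_on (cball (t m) R \<times> cball (t n) R) (\<lambda>(a, b). ?g a b)"
        by (rule time_holomorphic_on_imp_continuous2[OF f T(2)]) (rule R)
      show "(\<lambda>a. ?g a b) holomorphic_on ball (t m) R" if "b \<in> cball (t n) R" for b
        unfolding fun_upd_twist[OF False]
        by (rule time_holomorphic_on_imp_holomorphic[OF f])
           (use R that in \<open>auto simp: fun_upd_twist[OF False, symmetric]\<close>)
      show "?g a holomorphic_on ball (t n) R" if "a \<in> cball (t m) R" for a
        by (rule time_holomorphic_on_imp_holomorphic[OF f]) (use R that in auto)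
    qed (use R in auto)
    have "pd n f (t(m := a)) = deriv (?g a) (t n)" for a
      using False by (simp add: pd_def)
    moreover have "pd m f (t(n := b)) = deriv (\<lambda>a. ?g a b) (t m)" for b
      unfolding fun_upd_twist[OF False] using False by (simp add: pd_def)
    ultimately show ?thesis
      using d by (auto simp: pd_def[of _ "pd _ _"] field_differentiable_def DERIV_imp_deriv)
  qed
  then show "(\<lambda>s. pd n f (t(m := s))) field_differentiable (at (t m))" "pd m (pd n f) t = pd n (pd m f) t"
    by auto
qed

section \<open>Wirtinger calculus and its application to the solution\<close>

lemma has_derivative_wirtinger:
  assumes "f differentiable (at z)"
  shows "(f has_derivative (\<lambda>h. wirt f z * h + wirt_bar f z * cnj h)) (at z)"
proof -
  let ?D = "frechet_derivative f (at z)"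
  have D: "(f has_derivative ?D) (at z)"
    using assms frechet_derivative_works by blast
  then have lin: "linear ?D"
    by (rule has_derivative_linear)
  have "?D h = wirt f z * h + wirt_bar f z * cnj h" for h
  proof -
    have "?D h = ?D (Re h *\<^sub>R 1 + Im h *\<^sub>R \<i>)"
      by (rule arg_cong[of _ _ ?D]) (simp add: complex_eq_iff)
    also have "\<dots> = Re h * ?D 1 + Im h * ?D \<i>"
      by (simp only: linear_add[OF lin] linear_scale[OF lin]) (simp add: scaleR_conv_of_real)
    also have "\<dots> = wirt f z * (Re h + \<i> * Im h) + wirt_bar f z * (Re h - \<i> * Im h)"
      by (simp add: wirt_def wirt_bar_def field_simps)
    also have "\<dots> = wirt f z * h + wirt_bar f z * cnj h"
      by (simp add: complex_eq_iff)
    finally show ?thesis .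
  qed
  then have "?D = (\<lambda>h. wirt f z * h + wirt_bar f z * cnj h)" by auto
  with D show ?thesis by simp
qed

lemma wirt_eqI:
  assumes "(f has_derivative (\<lambda>h. a * h + b * cnj h)) (at z)"
  shows "wirt f z = a"
  using wirtinger_coeffs_unique(1)[OF has_derivative_wirtinger assms] assms differentiableI by blast

text \<open>A complex-linear outer derivative multiplies both Wirtinger coefficients by
  \<open>D\<close>. This permits differentiating polynomials in \<open>p(z)\<close> even where
  \<open>p\<close> is not holomorphic.\<close>

lemma wirt_compose_holomorphic:
  assumes "(g has_derivative (\<lambda>h. a * h + b * cnj h)) (at z)"
    and "(f has_field_derivative D) (at (g z))"
  shows "wirt (\<lambda>w. f (g w)) z = D * a"
proof (rule wirt_eqI)
  have "((\<lambda>w. f (g w)) has_derivative (\<lambda>h. D * (a * h + b * cnj h))) (at z)"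
    using has_derivative_compose[OF assms(1) assms(2)[THEN has_field_derivative_imp_has_derivative]]
    by simp
  then show "((\<lambda>w. f (g w)) has_derivative (\<lambda>h. D * a * h + D * b * cnj h)) (at z)"
    by (simp add: algebra_simps)
qed

context dBKP_solution
begin

text \<open>The locale assumes \<open>S_z\<close> continuous; its differentiability in each time,
  and the exchange of \<open>z\<close>-derivatives with time derivatives, come from the parameter
  lemma applied on a disc in the single time \<open>n\<close>.\<close>

lemma
  assumes t: "t \<in> T"
  shows S_z_time_differentiable: "(\<lambda>s. S_z S z (t(n := s))) field_differentiable (at (t n))"
    and has_derivative_pd_S: "((\<lambda>z. pd n (S z) t) has_derivative
           (\<lambda>h. pd n (S_z S z) t * h + pd n (S_zbar S z) t * cnj h)) (at z)"
proof -
  from finitely_open_fun_upd[OF T_open t] obtain R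
    where R: "R > 0" "\<And>a. a \<in> cball (t n) R \<Longrightarrow> t(n := a) \<in> T" by blast
  have cont: "continuous_on (UNIV \<times> cball (t n) R) (\<lambda>(z, x). f z (t(n := x)))"
    if "continuous_on (UNIV \<times> (T \<inter> slice t (Suc n))) (\<lambda>(z, s). f z s)"
    for f :: "complex \<Rightarrow> times \<Rightarrow> complex"
  proof -
    have "continuous_on (UNIV \<times> cball (t n) R) (\<lambda>p. (fst p, t(n := snd p)))"
      by (intro continuous_intros continuous_on_compose2[OF continuous_on_fun_upd2[of t n n],
            of _ "\<lambda>p. (snd p, snd p)", unfolded fst_conv snd_conv fun_upd_upd]) auto
    then show ?thesis
      unfolding split_beta
      by (rule continuous_on_compose2[OF that[unfolded split_beta],
            of _ "\<lambda>p. (fst p, t(n := snd p))", unfolded fst_conv snd_conv, OF _ subsetI])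
         (use R in \<open>auto simp: slice_def\<close>)
  qed
  have cont1: "continuous_on (cball (t n) R) (\<lambda>x. S z (t(n := x)))" for z
    by (rule continuous_on_compose2[OF cont[OF S_continuous[OF t]], of _ "\<lambda>x. (z, x)", simplified])
       (auto intro!: continuous_intros)
  have der: "((\<lambda>z. S z (t(n := x))) has_derivative
             (\<lambda>h. S_z S z (t(n := x)) * h + S_zbar S z (t(n := x)) * cnj h)) (at z)"
    if "x \<in> cball (t n) R" for z x
    using has_derivative_wirtinger[OF S_differentiable[OF R(2)[OF that]], of z]
    by (simp add: S_z_def S_zbar_def)
  have hol: "(\<lambda>x. S z (t(n := x))) holomorphic_on ball (t n) R" for z
    by (rule time_holomorphic_on_imp_holomorphic[OF S_time_holomorphic]) (use R in auto)
  note param = wirtinger_holomorphic_parameter[OF der cont1 hol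
      cont[OF S_z_continuous[OF t]] cont[OF S_zbar_continuous[OF t]] R(1)]
  show "(\<lambda>s. S_z S z (t(n := s))) field_differentiable (at (t n))"
    by (rule param(1))
  show "((\<lambda>z. pd n (S z) t) has_derivative
           (\<lambda>h. pd n (S_z S z) t * h + pd n (S_zbar S z) t * cnj h)) (at z)"
    unfolding pd_def by (rule param(2))
qed

lemma S_z_time_holomorphic: "time_holomorphic_on T (S_z S z)"
  unfolding time_holomorphic_on_def
proof (intro ballI allI conjI S_z_time_differentiable)
  fix t n assume "t \<in> T"
  show "continuous_on (T \<inter> slice t n) (S_z S z)"
    by (rule continuous_on_compose2[OF S_z_continuous[OF \<open>t \<in> T\<close>, of n], of _ "\<lambda>s. (z, s)", simplified])
       (auto intro!: continuous_intros)
qed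

text \<open>A single time occurs in one term of the series only, so \<open>S_zero\<close> is affine
  in it and can be differentiated without termwise limits.\<close>

lemma S_zero_fun_upd:
  assumes "t \<in> T"
  shows "S_zero z (t(n := x)) = S_zero z t + (x - t n) * z ^ (2 * n + 1)"
proof -
  have "(\<lambda>k. t k * z ^ (2 * k + 1) + (if k = n then (x - t n) * z ^ (2 * n + 1) else 0)) sums
          (S_zero z t + (x - t n) * z ^ (2 * n + 1))"
    unfolding S_zero_def
    by (intro sums_add summable_sums S_zero_summable[OF assms]
        sums_single[of n "\<lambda>_. (x - t n) * z ^ (2 * n + 1)"])
  also have "(\<lambda>k. t k * z ^ (2 * k + 1) + (if k = n then (x - t n) * z ^ (2 * n + 1) else 0)) =
             (\<lambda>k. (t(n := x)) k * z ^ (2 * k + 1))"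
    by (rule ext) (simp add: algebra_simps)
  finally show ?thesis
    unfolding S_zero_def[of z "t(n := x)"] by (rule sums_unique[symmetric])
qed

lemma S_field_differentiable:
  "t \<in> T \<Longrightarrow> (\<lambda>s. S z (t(n := s))) field_differentiable (at (t n))"
  using S_time_holomorphic unfolding time_holomorphic_on_def by blast

lemma S_tilde_fun_upd:
  assumes "t \<in> T"
  shows "S_tilde S z (t(n := x)) = S z (t(n := x)) - S_zero z t - (x - t n) * z ^ (2 * n + 1)"
  by (simp add: S_tilde_def S_zero_fun_upd[OF assms])

lemma pd_S_tilde:
  assumes "t \<in> T"
  shows "pd n (S_tilde S z) t = pd n (S z) t - z ^ (2 * n + 1)"
proof -
  have "((\<lambda>x. S z (t(n := x))) has_field_derivative pd n (S z) t) (at (t n))"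
    using S_field_differentiable[OF assms] by (simp add: pd_def DERIV_deriv_iff_field_differentiable)
  then have "((\<lambda>x. S_tilde S z (t(n := x))) has_field_derivative pd n (S z) t - z ^ (2 * n + 1)) (at (t n))"
    unfolding S_tilde_fun_upd[OF assms] by (auto intro!: derivative_eq_intros)
  then show ?thesis by (simp add: pd_def[of n "S_tilde S z"] DERIV_imp_deriv)
qed

section \<open>Parity and injectivity of \<open>p\<close>\<close>

lemma mom_minus:
  assumes "t \<in> T"
  shows "mom S (- z) t = - mom S z t"
proof -
  have "mom S (- z) t = pd_x (\<lambda>s. - S z s) t"
    unfolding mom_def by (rule pd_cong[OF T_open assms]) (rule S_odd)
  also have "\<dots> = - pd_x (S z) t"
    unfolding pd_def by (rule deriv_minus[OF S_field_differentiable[OF assms]])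
  finally show ?thesis by (simp add: mom_def)
qed

lemma mom_0: "t \<in> T \<Longrightarrow> mom S 0 t = 0"
  using mom_minus[of t 0] by simp

text \<open>If the numerator or the denominator vanished, the quotient would be 0 (division by 0
  gives 0), while the exponential on the right never is.\<close>

lemma
  assumes "t \<in> T" "norm z1 > 1" "z1 \<noteq> z" "z1 \<noteq> - z"
  shows mom_neq: "mom S z1 t \<noteq> mom S z t"
    and mom_neq_minus: "mom S z1 t \<noteq> - mom S z t"
  using generating[OF assms] by auto

text \<open>The point \<open>z\<close> is compared with 0, where \<open>p\<close> vanishes by
  oddness.\<close>

lemma mom_nonzero:
  assumes "t \<in> T" "norm z > 1"
  shows "mom S z t \<noteq> 0"
proof -
  have "z \<noteq> 0" using assms(2) by auto
  then show ?thesis using mom_neq[OF assms, of 0] mom_0[OF assms(1)] by simp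
qed

lemma inj_on_mom:
  assumes "t \<in> T"
  shows "inj_on (\<lambda>z. mom S z t) {z. norm z > 1}"
proof (rule inj_onI, clarify)
  fix z1 z assume *: "norm z1 > 1" "norm z > 1" "mom S z1 t = mom S z t"
  show "z1 = z"
  \<comment> \<open>The generating equation says nothing about opposite points; there oddness would
    force \<open>p(z) = 0\<close>.\<close>
  proof (cases "z1 = - z")
    case True
    with *(3) mom_minus[OF assms, of z] have "mom S z t = 0" by simp
    with mom_nonzero[OF assms *(2)] show ?thesis by simp
  qed (use mom_neq[OF assms *(1)] *(3) in auto)
qed

end

section \<open>Expansion at infinity\<close>

text \<open>
  Cauchy's formula in \<open>w\<close> on a circle, differentiated in the parameter: only joint continuity away from
  \<open>w = 0\<close> is needed.
\<close>
lemma holomorphic_deriv_parameter: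
  fixes f :: "complex \<Rightarrow> complex \<Rightarrow> complex"
  assumes cont: "continuous_on ((ball 0 1 - {0}) \<times> cball x0 R) (\<lambda>(w, x). f w x)"
    and holw: "\<And>x. x \<in> cball x0 R \<Longrightarrow> (\<lambda>w. f w x) holomorphic_on ball 0 1"
    and holx: "\<And>w. w \<in> ball 0 1 \<Longrightarrow> f w holomorphic_on ball x0 R"
    and "R > 0"
  shows deriv_parameter_holomorphic: "(\<lambda>w. deriv (f w) x0) holomorphic_on ball 0 1"
    and deriv_parameter_higher_deriv:
      "((\<lambda>x. (deriv ^^ k) (\<lambda>w. f w x) 0) has_field_derivative
          (deriv ^^ k) (\<lambda>w. deriv (f w) x0) 0) (at x0)"
proof -
  let ?K = "1 / (2 * of_real pi * \<i>) :: complex"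
  let ?G = "\<lambda>w. deriv (f w) x0"
  have x0: "x0 \<in> ball x0 R" using \<open>R > 0\<close> by simp
  have sph: "sphere 0 r \<subseteq> ball 0 1 - {0::complex}" if "0 < r" "r < 1" for r
    using that by auto
  have cont_r: "continuous_on (sphere 0 r \<times> cball x0 R) (\<lambda>(w, x). f w x)" if "0 < r" "r < 1" for r
    by (rule continuous_on_subset[OF cont]) (use sph[OF that] in auto)
  have contG: "continuous_on (sphere 0 r) ?G" if "0 < r" "r < 1" for r
    by (rule continuous_on_compose2[OF continuous_on_deriv_parameter[OF cont_r[OF that]],
            of _ "\<lambda>w. (w, x0)", unfolded split_beta fst_conv snd_conv])
       (use x0 that in \<open>auto intro!: continuous_intros holx\<close>)
  have der: "((\<lambda>x. ?K * contour_integral (circlepath 0 r) (\<lambda>v. f v x / (v - w) ^ k)) has_field_derivative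
          ?K * contour_integral (circlepath 0 r) (\<lambda>v. ?G v / (v - w) ^ k)) (at x0)"
    if r: "0 < r" "r < 1" and w: "w \<in> ball 0 r" for r w k
  proof (rule DERIV_cmult)
    have "((\<lambda>x. contour_integral (circlepath 0 r) (\<lambda>v. f v x / (v - w) ^ k)) has_field_derivative
          contour_integral (circlepath 0 r) (\<lambda>v. deriv (\<lambda>x. f v x / (v - w) ^ k) x0)) (at x0)"
    proof (rule contour_integral_holomorphic_parameter[OF _ _ _ x0])
      show "continuous_on (sphere 0 r \<times> cball x0 R) (\<lambda>(v, x). f v x / (v - w) ^ k)"
        unfolding split_beta
        by (intro continuous_intros cont_r[OF r, unfolded split_beta]) (use w in auto)
      show "(\<lambda>x. f v x / (v - w) ^ k) holomorphic_on ball x0 R" if "v \<in> sphere 0 r" for v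
        using sph[OF r] that w by (intro holomorphic_intros holx) auto
    qed (use r in auto)
    also have "contour_integral (circlepath 0 r) (\<lambda>v. deriv (\<lambda>x. f v x / (v - w) ^ k) x0) =
               contour_integral (circlepath 0 r) (\<lambda>v. ?G v / (v - w) ^ k)"
    proof (rule contour_integral_cong)
      fix v assume "v \<in> path_image (circlepath 0 r)"
      then have "f v field_differentiable (at x0)"
        using r holx[of v] x0 by (auto intro: holomorphic_on_imp_differentiable_at)
      then show "deriv (\<lambda>x. f v x / (v - w) ^ k) x0 = ?G v / (v - w) ^ k"
        by (rule deriv_cdivide_right)
    qed auto
    finally show "((\<lambda>x. contour_integral (circlepath 0 r) (\<lambda>v. f v x / (v - w) ^ k)) has_field_derivative
          contour_integral (circlepath 0 r) (\<lambda>v. ?G v / (v - w) ^ k)) (at x0)" .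
  qed
  have Cauchy: "(deriv ^^ k) (\<lambda>w. f w x) w = fact k *
      (?K * contour_integral (circlepath 0 r) (\<lambda>v. f v x / (v - w) ^ Suc k))"
    if r: "0 < r" "r < 1" and w: "w \<in> ball 0 r" and x: "x \<in> cball x0 R" for r w x k
  proof -
    have "(\<lambda>w. f w x) holomorphic_on cball 0 r"
      by (rule holomorphic_on_subset[OF holw[OF x]]) (use r in auto)
    then show ?thesis
      by (subst Cauchy_higher_derivative_integral_circlepath(2)[OF _ _ w])
         (auto intro: holomorphic_on_imp_continuous_on holomorphic_on_subset)
  qed
  \<comment> \<open>Cauchy's formula in \<open>w\<close> is differentiated at \<open>x0\<close>, so
    \<open>?G\<close> inherits it at every \<open>w\<close> of the disc, including the
    centre.\<close>
  have G_eq: "?G w = ?K * contour_integral (circlepath 0 r) (\<lambda>v. ?G v / (v - w) ^ 1)"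
    if r: "0 < r" "r < 1" and w: "w \<in> ball 0 r" for r w
  proof (rule DERIV_imp_deriv, rule has_field_derivative_transform_within_open[OF der[OF that] open_ball x0])
    show "?K * contour_integral (circlepath 0 r) (\<lambda>v. f v x / (v - w) ^ 1) = f w x"
      if "x \<in> ball x0 R" for x
      using Cauchy[OF r w, of x 0] that by simp
  qed
  have hol_r: "?G holomorphic_on ball 0 r" if r: "0 < r" "r < 1" for r
  proof -
    have "(\<lambda>w. ?K * contour_integral (circlepath 0 r) (\<lambda>v. ?G v / (v - w) ^ 1)) holomorphic_on ball 0 r"
    proof (intro holomorphic_on_mult holomorphic_on_const)
      have "((\<lambda>w. contour_integral (circlepath 0 r) (\<lambda>v. ?G v / (v - w) ^ 1)) has_field_derivative
              of_nat 1 * contour_integral (circlepath 0 r) (\<lambda>v. ?G v / (v - w) ^ Suc 1)) (at w)"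
        if "w \<in> ball 0 r" for w
      proof (rule Cauchy_next_derivative_circlepath(2))
        show "((\<lambda>v. ?G v / (v - w) ^ 1) has_contour_integral
                contour_integral (circlepath 0 r) (\<lambda>v. ?G v / (v - w) ^ 1)) (circlepath 0 r)"
          if "w \<in> ball 0 r" for w
          using contG[OF r] r that
          by (intro has_contour_integral_integral contour_integrable_continuous_circlepath)
             (auto intro!: continuous_intros)
      qed (use contG[OF r] r that in auto)
      then show "(\<lambda>w. contour_integral (circlepath 0 r) (\<lambda>v. ?G v / (v - w) ^ 1)) holomorphic_on ball 0 r"
        unfolding holomorphic_on_def field_differentiable_def
        using has_field_derivative_at_within by blast
    qed
    then show ?thesis
      by (rule holomorphic_transform) (simp only: G_eq[OF r, symmetric])
  qed
  show hol: "?G holomorphic_on ball 0 1"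
    unfolding holomorphic_on_def
  proof
    fix w :: complex assume "w \<in> ball 0 1"
    \<comment> \<open>The radius is midway between \<open>norm w\<close> and 1, so the circle
      encloses \<open>w\<close> and stays where \<open>f\<close> is known to be continuous.\<close>
    then have "w \<in> ball 0 ((1 + norm w) / 2)" "0 < (1 + norm w) / 2" "(1 + norm w) / 2 < 1"
      by (auto simp: add_pos_nonneg)
    then show "?G field_differentiable (at w within ball 0 1)"
      using hol_r by (meson field_differentiable_at_within holomorphic_on_imp_differentiable_at open_ball)
  qed
  have half: "0 < (1/2::real)" "(1/2::real) < 1" "(0::complex) \<in> ball 0 (1/2)" by auto
  have "(deriv ^^ k) ?G 0 =
      fact k * (?K * contour_integral (circlepath 0 (1/2)) (\<lambda>v. ?G v / (v - 0) ^ Suc k))"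
    by (subst Cauchy_higher_derivative_integral_circlepath(2)[OF _ _ half(3)])
       (auto intro!: holomorphic_on_imp_continuous_on holomorphic_on_subset[OF hol])
  moreover have "((\<lambda>x. fact k * (?K * contour_integral (circlepath 0 (1/2)) (\<lambda>v. f v x / (v - 0) ^ Suc k)))
      has_field_derivative
      fact k * (?K * contour_integral (circlepath 0 (1/2)) (\<lambda>v. ?G v / (v - 0) ^ Suc k))) (at x0)"
    by (rule DERIV_cmult[OF der[OF half]])
  then have "((\<lambda>x. (deriv ^^ k) (\<lambda>w. f w x) 0) has_field_derivative
      fact k * (?K * contour_integral (circlepath 0 (1/2)) (\<lambda>v. ?G v / (v - 0) ^ Suc k))) (at x0)"
    by (rule has_field_derivative_transform_within_open[OF _ open_ball x0])
       (subst Cauchy[OF half]; simp)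
  ultimately show "((\<lambda>x. (deriv ^^ k) (\<lambda>w. f w x) 0) has_field_derivative (deriv ^^ k) ?G 0) (at x0)"
    by simp
qed

text \<open>
  Series in \<open>1/z\<close> are read as power series in \<open>w = 1/z\<close>; at \<open>w = 0\<close> the convention \<open>1/0 = 0\<close> gives the
  correct limit value 0.
\<close>
lemma vertex_op_has_fps_expansion:
  assumes "\<And>z. norm z > 1 \<Longrightarrow> summable (vertex_term z f t)"
  shows "(\<lambda>w. vertex_op (1 / w) f t) has_fps_expansion
           Abs_fps (\<lambda>n. if odd n then 2 / of_nat n * pd (n div 2) f t else 0)"
proof (rule has_fps_expansionI)
  let ?c = "\<lambda>n. if odd n then 2 / of_nat n * pd (n div 2) f t else 0 :: complex"
  have "(\<lambda>n. ?c n * w ^ n) sums vertex_op (1 / w) f t" if "norm w < 1" for w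
  proof -
    have "summable (vertex_term (1 / w) f t)"
    proof (cases "w = 0")
      case False
      with that have "norm (1 / w) > 1" by (simp add: norm_divide)
      then show ?thesis by (rule assms)
    qed (simp add: vertex_term_def[abs_def])
    then have "(\<lambda>n. 2 * vertex_term (1 / w) f t n) sums vertex_op (1 / w) f t"
      unfolding vertex_op_def by (intro sums_mult summable_sums)
    also have "(\<lambda>n. 2 * vertex_term (1 / w) f t n) = (\<lambda>n. ?c (2 * n + 1) * w ^ (2 * n + 1))"
      by (simp add: vertex_term_def fun_eq_iff power_one_over divide_simps)
    finally show ?thesis
      by (subst (asm) sums_mono_reindex[of "\<lambda>n. 2 * n + 1"])
         (auto simp: strict_mono_def elim!: oddE)
  qed
  then have *: "(\<lambda>n. Abs_fps ?c $ n * w ^ n) sums vertex_op (1 / w) f t" if "w \<in> ball 0 1" for w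
    using that by simp
  have "\<forall>\<^sub>F w in nhds 0. w \<in> ball (0::complex) 1"
    by (intro eventually_nhds_in_open) auto
  then show "\<forall>\<^sub>F w in nhds 0. (\<lambda>n. Abs_fps ?c $ n * w ^ n) sums vertex_op (1 / w) f t"
    by eventually_elim (rule *)
qed

context dBKP_solution
begin

text \<open>At \<open>w = 0\<close> the term \<open>1 / w\<close> is 0, so this is the value used
  for infinity; oddness of \<open>S\<close> makes it agree with the limit there.\<close>

lemma S_tilde_0: "t \<in> T \<Longrightarrow> S_tilde S 0 t = 0"
  using S_odd[of t 0] by (simp add: S_tilde_def S_zero_def)

lemma S_tilde_sums:
  assumes "t \<in> T" "norm w < 1"
  shows "(\<lambda>n. (if n = 0 then 0 else A n t) * w ^ n) sums S_tilde S (1 / w) t"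
proof -
  have "(\<lambda>i. A (Suc i) t * w ^ Suc i) sums S_tilde S (1 / w) t"
  proof (cases "w = 0")
    case False
    with assms have "norm (1 / w) > 1" by (simp add: norm_divide)
    from S_tilde_expansion[OF assms(1) this] show ?thesis
      by (simp add: power_one_over)
  qed (simp add: S_tilde_0 assms)
  then show ?thesis
    using sums_Suc_iff[of "\<lambda>n. (if n = 0 then 0 else A n t) * w ^ n" "S_tilde S (1 / w) t"] by simp
qed

lemma S_tilde_holomorphic_inverse:
  "t \<in> T \<Longrightarrow> (\<lambda>w. S_tilde S (1 / w) t) holomorphic_on ball 0 1"
  using S_tilde_sums by (intro power_series_holomorphic) auto

lemma S_tilde_has_fps_expansion:
  assumes "t \<in> T"
  shows "(\<lambda>w. S_tilde S (1 / w) t) has_fps_expansion Abs_fps (\<lambda>n. if n = 0 then 0 else A n t)"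
proof (rule has_fps_expansionI)
  have "\<forall>\<^sub>F w in nhds 0. w \<in> ball (0::complex) 1"
    by (intro eventually_nhds_in_open) auto
  then show "\<forall>\<^sub>F w in nhds 0. (\<lambda>n. Abs_fps (\<lambda>n. if n = 0 then 0 else A n t) $ n * w ^ n) sums S_tilde S (1 / w) t"
    by eventually_elim (use S_tilde_sums[OF assms] in auto)
qed

text \<open>The expansion of \<open>p(z) - z\<close> at infinity in powers of
  \<open>w = 1/z\<close>. Index 0 is cut off because \<open>A 0\<close> is not a coefficient of
  \<open>S_tilde\<close>.\<close>

definition mom_series :: "times \<Rightarrow> complex fps" where
  "mom_series t = Abs_fps (\<lambda>n. if n = 0 then 0 else pd_x (A n) t)"

lemma mom_inverse: "t \<in> T \<Longrightarrow> mom S (1 / w) t = 1 / w + pd_x (S_tilde S (1 / w)) t"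
  by (simp add: mom_def pd_S_tilde)

text \<open>The expansion may be differentiated in \<open>x\<close> term by term, because its
  coefficients are Cauchy integrals over a fixed circle in \<open>w\<close>.\<close>

lemma pd_x_S_tilde_inverse:
  assumes t: "t \<in> T"
  shows pd_x_S_tilde_holomorphic: "(\<lambda>w. pd_x (S_tilde S (1 / w)) t) holomorphic_on ball 0 1"
    and pd_x_S_tilde_has_fps_expansion:
      "(\<lambda>w. pd_x (S_tilde S (1 / w)) t) has_fps_expansion mom_series t"
proof -
  from finitely_open_fun_upd[OF T_open t] obtain R
    where R: "R > 0" "\<And>a. a \<in> cball (t 0) R \<Longrightarrow> t(0 := a) \<in> T" by blast
  let ?f = "\<lambda>w x. S_tilde S (1 / w) (t(0 := x))"
  let ?U = "ball 0 1 - {0 :: complex}"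
  have contS: "continuous_on (?U \<times> cball (t 0) R) (\<lambda>p. S (1 / fst p) (t(0 := snd p)))"
  proof -
    have "continuous_on (?U \<times> cball (t 0) R) (\<lambda>p. (1 / fst p, t(0 := snd p)))"
      by (intro continuous_intros continuous_on_compose2[OF continuous_on_fun_upd2[of t 0 0],
            of _ "\<lambda>p. (snd p, snd p)", unfolded fst_conv snd_conv fun_upd_upd]) auto
    then show ?thesis
      by (rule continuous_on_compose2[OF S_continuous[OF t, of 1, unfolded split_beta],
            of _ "\<lambda>p. (1 / fst p, t(0 := snd p))", unfolded fst_conv snd_conv, OF _ subsetI])
         (use R in \<open>auto simp: slice_def\<close>)
  qed
  \<comment> \<open>Continuity of \<open>S_zero\<close> in \<open>w\<close> is obtained indirectly:
    it is the difference of \<open>S\<close>, continuous by assumption, and \<open>S_tilde\<close>,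
    holomorphic in \<open>w\<close>.\<close>
  have "continuous_on ?U (\<lambda>w. S (1 / w) t)"
    using R(1) by (intro continuous_on_compose2[OF contS, of _ "\<lambda>w. (w, t 0)", simplified])
       (auto intro!: continuous_intros)
  moreover have "continuous_on ?U (\<lambda>w. S_tilde S (1 / w) t)"
    by (rule continuous_on_subset[OF holomorphic_on_imp_continuous_on[OF S_tilde_holomorphic_inverse[OF t]]]) auto
  ultimately have "continuous_on ?U (\<lambda>w. S (1 / w) t - S_tilde S (1 / w) t)"
    by (rule continuous_on_diff)
  then have "continuous_on ?U (\<lambda>w. S_zero (1 / w) t)"
    by (simp add: S_tilde_def)
  then have cont0: "continuous_on (?U \<times> cball (t 0) R) (\<lambda>p. S_zero (1 / fst p) t)"
    by (rule continuous_on_compose2[of ?U _ _ fst]) (auto intro!: continuous_intros)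
  have cont: "continuous_on (?U \<times> cball (t 0) R) (\<lambda>(w, x). ?f w x)"
    unfolding split_beta S_tilde_fun_upd[OF t]
    by (intro continuous_intros contS cont0) auto
  have holw: "(\<lambda>w. ?f w x) holomorphic_on ball 0 1" if "x \<in> cball (t 0) R" for x
    by (rule S_tilde_holomorphic_inverse) (rule R(2)[OF that])
  have holx: "?f w holomorphic_on ball (t 0) R" for w
    unfolding S_tilde_fun_upd[OF t]
    by (intro holomorphic_intros time_holomorphic_on_imp_holomorphic[OF S_time_holomorphic]) (use R in auto)
  note * = holomorphic_deriv_parameter[OF cont holw holx R(1)]
  show hol: "(\<lambda>w. pd_x (S_tilde S (1 / w)) t) holomorphic_on ball 0 1"
    using *(1) by (simp add: pd_def)
  have coeff: "(deriv ^^ n) (\<lambda>w. ?f w x) 0 = fact n * (if n = 0 then 0 else A n (t(0 := x)))"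
    if "x \<in> ball (t 0) R" for x n
    using fps_nth_fps_expansion[OF S_tilde_has_fps_expansion[OF R(2)], of x n] that
    by (simp add: field_simps split: if_splits)
  have "fps_expansion (\<lambda>w. pd_x (S_tilde S (1 / w)) t) 0 $ n = mom_series t $ n" for n
  proof -
    have "((\<lambda>x. (deriv ^^ n) (\<lambda>w. ?f w x) 0 / fact n) has_field_derivative
            (deriv ^^ n) (\<lambda>w. pd_x (S_tilde S (1 / w)) t) 0 / fact n) (at (t 0))"
      unfolding pd_def by (rule DERIV_cdivide, rule *(2))
    then have "((\<lambda>x. if n = 0 then 0 else A n (t(0 := x))) has_field_derivative
            (deriv ^^ n) (\<lambda>w. pd_x (S_tilde S (1 / w)) t) 0 / fact n) (at (t 0))"
      by (rule has_field_derivative_transform_within_open[OF _ open_ball[of "t 0" R]])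
         (use R(1) coeff in auto)
    from DERIV_imp_deriv[OF this] show ?thesis
      by (auto simp: fps_expansion_def mom_series_def pd_def)
  qed
  then have "fps_expansion (\<lambda>w. pd_x (S_tilde S (1 / w)) t) 0 = mom_series t"
    by (rule fps_ext)
  then show "(\<lambda>w. pd_x (S_tilde S (1 / w)) t) has_fps_expansion mom_series t"
    using has_fps_expansion_fps_expansion[OF open_ball _ hol] by simp
qed

lemma mom_holomorphic:
  assumes t: "t \<in> T"
  shows "(\<lambda>z. mom S z t) holomorphic_on {z. norm z > 1}"
proof -
  have "(\<lambda>z. z + ((\<lambda>w. pd_x (S_tilde S (1 / w)) t) \<circ> (\<lambda>z. 1 / z)) z) holomorphic_on {z. norm z > 1}"
    by (intro holomorphic_intros holomorphic_on_compose_gen[OF _ pd_x_S_tilde_holomorphic[OF t]])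
       (auto simp: norm_divide divide_less_eq)
  then show ?thesis
    using mom_inverse[OF t, of "1 / z" for z] by simp
qed

end

section \<open>The generating equation as an identity of power series\<close>

lemma fps_expansion_unique_eventually:
  fixes f g :: "complex \<Rightarrow> complex"
  assumes "f has_fps_expansion F" "g has_fps_expansion F"
  shows "\<forall>\<^sub>F w in nhds 0. f w = g w"
  using assms unfolding has_fps_expansion_def by (auto elim: eventually_elim2)

text \<open>This is \<open>2 artanh v\<close> for small \<open>v\<close>. Split into two logarithms,
  it gets its expansion from the series of \<open>Ln\<close>, where even powers cancel.\<close>

definition log_quotient :: "complex \<Rightarrow> complex" where
  "log_quotient v = Ln (1 + v) - Ln (1 - v)"

definition log_quotient_series :: "complex fps" where
  "log_quotient_series = Abs_fps (\<lambda>k. if odd k then 2 / of_nat k else 0)"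

lemma log_quotient_0 [simp]: "log_quotient 0 = 0"
  by (simp add: log_quotient_def)

lemma exp_log_quotient:
  assumes "norm v < 1"
  shows "exp (log_quotient v) = (1 + v) / (1 - v)"
proof -
  have "1 + v \<noteq> 0" "1 - v \<noteq> 0"
    using assms by (auto simp: add_eq_0_iff)
  then show ?thesis by (simp add: log_quotient_def exp_diff)
qed

lemma log_quotient_has_fps_expansion: "log_quotient has_fps_expansion log_quotient_series"
proof (rule has_fps_expansionI)
  have *: "(\<lambda>n. log_quotient_series $ n * u ^ n) sums log_quotient u" if "norm u < 1" for u
  proof -
    have "(\<lambda>n. - ((- u) ^ n) / of_nat n - - ((- (- u)) ^ n) / of_nat n) sums (Ln (1 + u) - Ln (1 + - u))"
      using that by (intro sums_diff Ln_series') auto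
    also have "(\<lambda>n. - ((- u) ^ n) / of_nat n - - ((- (- u)) ^ n) / of_nat n) =
               (\<lambda>n. log_quotient_series $ n * u ^ n)"
    proof
      fix n show "- ((- u) ^ n) / of_nat n - - ((- (- u)) ^ n) / of_nat n = log_quotient_series $ n * u ^ n"
        by (cases "even n") (auto simp: log_quotient_series_def diff_divide_distrib[symmetric])
    qed
    finally show ?thesis by (simp add: log_quotient_def)
  qed
  have "\<forall>\<^sub>F u in nhds 0. u \<in> ball (0::complex) 1"
    by (intro eventually_nhds_in_open) auto
  then show "\<forall>\<^sub>F u in nhds 0. (\<lambda>n. log_quotient_series $ n * u ^ n) sums log_quotient u"
    by eventually_elim (use * in auto)
qed

text \<open>The expansion in \<open>x\<close> of \<open>\<partial>\<^sub>v\<close> of \<open>log_quotient (v * x)\<close>.\<close>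
definition log_quotient_deriv_series :: "complex \<Rightarrow> complex fps" where
  "log_quotient_deriv_series v = Abs_fps (\<lambda>k. log_quotient_series $ k * (of_nat k * v ^ (k - 1)))"

lemma log_quotient_deriv_series_nth:
  "log_quotient_deriv_series v $ k = (if odd k then 2 * v ^ (k - 1) else 0)"
  by (auto simp: log_quotient_deriv_series_def log_quotient_series_def)

text \<open>The coefficients form a geometric series in \<open>v^2\<close>, so multiplication by
  \<open>1 - v^2 x^2\<close> telescopes to \<open>2 x\<close>; dividing by this invertible series
  gives the claim.\<close>

lemma log_quotient_deriv_series_has_fps_expansion:
  "(\<lambda>x. 2 * x / (1 - v\<^sup>2 * x\<^sup>2)) has_fps_expansion log_quotient_deriv_series v"
proof -
  let ?D = "log_quotient_deriv_series v" and ?U = "1 - fps_const (v\<^sup>2) * fps_X ^ 2"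
  have "(?D * ?U) $ k = (fps_const 2 * fps_X) $ k" for k
  proof -
    have "(?D * ?U) $ k = ?D $ k - v\<^sup>2 * (if k < 2 then 0 else ?D $ (k - 2))"
    proof -
      have "?D * ?U = ?D - fps_const (v\<^sup>2) * (?D * fps_X ^ 2)"
        by (simp add: algebra_simps)
      then show ?thesis by (simp add: fps_X_power_mult_right_nth)
    qed
    also have "\<dots> = (fps_const 2 * fps_X) $ k"
    proof -
      consider "k = 0" | "k = 1" | m where "k = m + 2" by (metis One_nat_def Suc_1 add.commute less_2_cases le_Suc_ex not_less)
      then show ?thesis
      proof cases
        case 3
        then show ?thesis
          by (cases m) (auto simp: log_quotient_deriv_series_nth power2_eq_square)
      qed (auto simp: log_quotient_deriv_series_nth)
    qed
    finally show ?thesis .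
  qed
  then have DU: "?D * ?U = fps_const 2 * fps_X" by (rule fps_ext)
  have U: "(\<lambda>x. inverse (1 - v\<^sup>2 * x\<^sup>2)) has_fps_expansion inverse ?U"
    by (intro fps_expansion_intros) simp
  have "(\<lambda>x. 2 * x * inverse (1 - v\<^sup>2 * x\<^sup>2)) has_fps_expansion fps_const 2 * fps_X * inverse ?U"
    by (intro has_fps_expansion_mult U has_fps_expansion_cmult_left has_fps_expansion_fps_X)
  also have "fps_const 2 * fps_X * inverse ?U = ?D"
    unfolding DU[symmetric] by (simp add: mult.assoc inverse_mult_eq_1')
  finally show ?thesis by (simp add: divide_inverse)
qed

text \<open>This expands \<open>1 / p(1/w)\<close>: since \<open>p(1/w) = 1/w + m(w)\<close> with
  \<open>m\<close> expanded by \<open>mom_series\<close>, it equals \<open>w / (1 + w m(w))\<close>,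
  which removes the pole of \<open>p\<close> at infinity.\<close>

definition (in dBKP_solution) recip_series :: "times \<Rightarrow> complex fps" where
  "recip_series t = fps_X * inverse (1 + fps_X * mom_series t)"

section \<open>All flows read off from the generating equation\<close>

context dBKP_solution
begin

lemma recip_series_0 [simp]: "recip_series t $ 0 = 0"
  by (simp add: recip_series_def)

lemma recip_mom_has_fps_expansion:
  assumes "t \<in> T"
  shows "(\<lambda>w. 1 / mom S (1 / w) t) has_fps_expansion recip_series t"
proof -
  have "(\<lambda>w. w * inverse (1 + w * pd_x (S_tilde S (1 / w)) t)) has_fps_expansion recip_series t"
    unfolding recip_series_def
    by (intro fps_expansion_intros pd_x_S_tilde_has_fps_expansion assms) simp
  moreover have "w * inverse (1 + w * pd_x (S_tilde S (1 / w)) t) = 1 / mom S (1 / w) t" for w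
  proof (cases "w = 0")
    case True
    then show ?thesis using mom_0[OF assms] by simp
  next
    case False
    then have "1 + w * pd_x (S_tilde S (1 / w)) t = w * mom S (1 / w) t"
      by (simp add: mom_inverse[OF assms] algebra_simps)
    with False show ?thesis by (simp add: field_simps)
  qed
  ultimately show ?thesis by simp
qed

text \<open>For small \<open>w\<close> the generating equation equates the exponentials of two
  logarithms that both vanish at \<open>w = 0\<close>. Hence the logarithms agree near 0, and so do
  their coefficients.\<close>

lemma pd_S_eq_coeff:
  assumes t: "t \<in> T"
  shows "(log_quotient_series oo (fps_const (mom S z t) * recip_series t)) $ n =
           (if odd n then 2 / of_nat n * pd (n div 2) (S z) t else 0)"
proof -
  let ?p = "mom S z t" and ?q = "\<lambda>w. 1 / mom S (1 / w) t"
  let ?V = "\<lambda>w. vertex_op (1 / w) (S_tilde S z) t"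
  let ?M = "\<lambda>w. ?V w + log_quotient (z * w)"
  define L where "L = Abs_fps (\<lambda>n. if odd n then 2 / of_nat n * pd (n div 2) (S_tilde S z) t else 0)
                        + (log_quotient_series oo (fps_const z * fps_X))"
  have V: "?V has_fps_expansion Abs_fps (\<lambda>n. if odd n then 2 / of_nat n * pd (n div 2) (S_tilde S z) t else 0)"
    by (intro vertex_op_has_fps_expansion vertex_summable t)
  have pq: "(\<lambda>w. ?p * ?q w) has_fps_expansion fps_const ?p * recip_series t"
    by (intro has_fps_expansion_cmult_left recip_mom_has_fps_expansion t)
  have zw: "(\<lambda>w. z * w) has_fps_expansion fps_const z * fps_X"
    by (intro fps_expansion_intros)
  have M: "?M has_fps_expansion L"
    unfolding L_def
    using has_fps_expansion_compose[OF log_quotient_has_fps_expansion zw]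
    by (intro has_fps_expansion_add V) (simp add: o_def)
  have H: "(\<lambda>w. log_quotient (?p * ?q w)) has_fps_expansion
             (log_quotient_series oo (fps_const ?p * recip_series t))"
    using has_fps_expansion_compose[OF log_quotient_has_fps_expansion pq] by (simp add: o_def)
  have L0: "L $ 0 = 0" by (simp add: L_def log_quotient_series_def)
  have small: "\<forall>\<^sub>F w in nhds 0. norm (f w) < 1"
    if "f has_fps_expansion G" "G $ 0 = 0" for f :: "complex \<Rightarrow> complex" and G :: "complex fps"
  proof -
    have "(f \<longlongrightarrow> 0) (nhds 0)"
      using has_fps_expansion_imp_tendsto_0[OF that(1)] that(2) by simp
    from tendstoD[OF this, of 1] show ?thesis by simp
  qed
  have "\<forall>\<^sub>F w in nhds 0. norm (w :: complex) < 1"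
    by (rule small[OF has_fps_expansion_fps_X]) simp
  moreover have "\<forall>\<^sub>F w in nhds 0. norm (z * w) < 1"
    by (rule small[OF zw]) simp
  moreover have "\<forall>\<^sub>F w in nhds 0. norm (?p * ?q w) < 1"
    by (rule small[OF pq]) simp
  \<comment> \<open>This bound and the next one fix the branch: both logarithms have norm below
    1.\<close>
  moreover have "\<forall>\<^sub>F w in nhds 0. norm (?M w) < 1"
    by (rule small[OF M L0])
  moreover have "\<forall>\<^sub>F w in nhds 0. norm (log_quotient (?p * ?q w)) < 1"
    by (rule small[OF H]) (simp add: log_quotient_series_def)
  ultimately have "\<forall>\<^sub>F w in nhds 0. log_quotient (?p * ?q w) = ?M w"
  proof eventually_elim
    case (elim w)
    show ?case
    proof (cases "w = 0")
      case True
      then show ?thesis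
        using mom_0[OF t] has_fps_expansion_imp_0_eq_fps_nth_0[OF V] by simp
    next
      case False
      have w1: "norm (1 / w) > 1" using elim(1) False by (simp add: norm_divide)
      \<comment> \<open>Smallness of \<open>z * w\<close> keeps \<open>1 / w\<close> away from the
        two points excluded from the generating equation.\<close>
      have "z * w \<noteq> 1" "z * w \<noteq> - 1" using elim(2) by auto
      then have wz: "1 / w \<noteq> z" "1 / w \<noteq> - z"
        using False by (simp_all add: divide_eq_eq eq_commute[of 1] minus_equation_iff[of "z * w"])
      have nz: "mom S (1 / w) t \<noteq> 0"
        by (rule mom_nonzero[OF t w1])
      have "exp (- log_quotient (?p * ?q w)) = (1 - ?p * ?q w) / (1 + ?p * ?q w)"
        unfolding exp_minus exp_log_quotient[OF elim(3)] by simp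
      also have "\<dots> = (mom S (1 / w) t - ?p) / (mom S (1 / w) t + ?p)"
      proof -
        have "1 - ?p * ?q w = (mom S (1 / w) t - ?p) / mom S (1 / w) t"
          "1 + ?p * ?q w = (mom S (1 / w) t + ?p) / mom S (1 / w) t"
          using nz by (simp_all add: field_simps)
        then show ?thesis using nz by simp
      qed
      also have "\<dots> = exp (- vertex_S S (1 / w) z t)"
        by (rule generating[OF t w1 wz])
      also have "\<dots> = exp (- ?M w)"
      proof -
        have eq: "(1 / w + z) / (1 / w - z) = (1 + z * w) / (1 - z * w)"
        proof -
          have "1 / w + z = (1 + z * w) / w" "1 / w - z = (1 - z * w) / w"
            using False by (simp_all add: field_simps)
          then show ?thesis using False by simp
        qed
        have "1 + z * w \<noteq> 0" "1 - z * w \<noteq> 0"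
          using \<open>z * w \<noteq> 1\<close> \<open>z * w \<noteq> - 1\<close> by (auto simp: add_eq_0_iff)
        then have "exp (vertex_S S (1 / w) z t) = exp (?M w)"
          by (simp add: vertex_S_def eq exp_add exp_log_quotient[OF elim(2)])
        then show ?thesis by (simp only: exp_minus)
      qed
      finally have "exp (log_quotient (?p * ?q w)) = exp (?M w)"
        by (simp only: exp_minus inverse_eq_iff_eq)
      \<comment> \<open>The imaginary parts differ by less than 2, hence by less than a period of
        the exponential.\<close>
      moreover have "\<bar>Im (log_quotient (?p * ?q w)) - Im (?M w)\<bar> < 2 * pi"
        using abs_Im_le_cmod[of "log_quotient (?p * ?q w)"] abs_Im_le_cmod[of "?M w"] elim(4,5) pi_gt3
        by linarith
      ultimately show ?thesis by (rule exp_complex_eqI[rotated])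
    qed
  qed
  from has_fps_expansion_cong[OF this refl] M H
  have "log_quotient_series oo (fps_const ?p * recip_series t) = L"
    using fps_expansion_unique_complex by blast
  then have "(log_quotient_series oo (fps_const ?p * recip_series t)) $ n = L $ n"
    by (rule arg_cong)
  \<comment> \<open>The coefficient \<open>2 / n * z ^ n\<close> contributed by
    \<open>log_quotient (z * w)\<close> is the derivative of \<open>S_zero\<close> that completes
    \<open>S_tilde\<close> to \<open>S\<close>.\<close>
  also have "\<dots> = (if odd n then 2 / of_nat n * pd (n div 2) (S z) t else 0)"
    unfolding L_def fps_compose_linear log_quotient_series_def
    by (simp add: pd_S_tilde[OF t] right_diff_distrib diff_divide_distrib)
  finally show ?thesis .
qed

text \<open>A coefficient of a composition is a finite sum, here a polynomial in \<open>v\<close>,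
  so no convergence question arises.\<close>

lemma coeff_deriv:
  "((\<lambda>v. (log_quotient_series oo (fps_const v * Q)) $ n) has_field_derivative
      (log_quotient_deriv_series v oo Q) $ n) (at v)"
  by (auto simp: fps_compose_nth power_mult_distrib log_quotient_deriv_series_def
      intro!: derivative_eq_intros sum.cong)

text \<open>Apply the Wirtinger derivative in \<open>z\<close> to \<open>pd_S_eq_coeff\<close>: the
  left side is a polynomial in \<open>p(z)\<close>, whose own derivative is
  \<open>phi\<close>.\<close>

lemma pd_S_z_eq_coeff:
  assumes t: "t \<in> T"
  shows "(log_quotient_deriv_series (mom S z t) oo recip_series t) $ n * phi S z t =
           (if odd n then 2 / of_nat n * pd (n div 2) (S_z S z) t else 0)"
proof -
  let ?C = "\<lambda>v. (log_quotient_series oo (fps_const v * recip_series t)) $ n"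
  let ?a = "if odd n then 2 / of_nat n else 0 :: complex"
  have "((\<lambda>z. mom S z t) has_derivative
          (\<lambda>h. phi S z t * h + pd_x (S_zbar S z) t * cnj h)) (at z)"
    unfolding mom_def phi_def by (rule has_derivative_pd_S[OF t])
  from wirt_compose_holomorphic[OF this coeff_deriv]
  have "wirt (\<lambda>w. ?C (mom S w t)) z =
      (log_quotient_deriv_series (mom S z t) oo recip_series t) $ n * phi S z t" .
  moreover have "(\<lambda>w. ?C (mom S w t)) = (\<lambda>w. ?a * pd (n div 2) (S w) t)"
    by (auto simp: pd_S_eq_coeff[OF t])
  moreover have "wirt (\<lambda>w. ?a * pd (n div 2) (S w) t) z = ?a * pd (n div 2) (S_z S z) t"
    by (rule wirt_compose_holomorphic[OF has_derivative_pd_S[OF t]]) (auto intro!: derivative_eq_intros)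
  ultimately show ?thesis by (cases "odd n") auto
qed

text \<open>In short \<open>1 / p(1/w) = w + u w^3 + ...\<close>, because \<open>mom_series\<close>
  starts with \<open>- u w\<close>. These are the numbers that enter the \<open>w^3\<close>
  coefficient of the flows.\<close>

lemma recip_series_nth:
  shows "recip_series t $ 1 = 1" "recip_series t $ 3 = potential A t"
    "(recip_series t ^ 2) $ 3 = 0" "(recip_series t ^ 3) $ 3 = 1"
proof -
  let ?U = "1 + fps_X * mom_series t"
  define R where "R = inverse ?U"
  have "R * ?U = 1" unfolding R_def by (rule inverse_mult_eq_1) simp
  then have "R + fps_X * (R * mom_series t) = 1" by (simp add: algebra_simps)
  then have *: "R $ k + (fps_X * (R * mom_series t)) $ k = 1 $ k" for k
    by (metis fps_add_nth)
  have B: "mom_series t $ 0 = 0" "mom_series t $ Suc 0 = - potential A t"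
    by (simp_all add: mom_series_def potential_def)
  have R: "R $ 0 = 1" "R $ 1 = 0" "R $ 2 = potential A t"
    using *[of 0] *[of 1] *[of 2] by (simp_all add: B fps_mult_nth numeral_2_eq_2)
  have Q: "recip_series t = fps_X * R" by (simp add: recip_series_def R_def)
  show "recip_series t $ 1 = 1" "recip_series t $ 3 = potential A t"
    using R by (simp_all add: Q)
  have "(recip_series t ^ 2) $ 3 = (R ^ 2) $ 1" "(recip_series t ^ 3) $ 3 = (R ^ 3) $ 0"
    unfolding Q power_mult_distrib fps_X_power_mult_nth by simp_all
  then show "(recip_series t ^ 2) $ 3 = 0" "(recip_series t ^ 3) $ 3 = 1"
    using R by (simp_all add: fps_mult_nth power2_eq_square power3_eq_cube)
qed

text \<open>The \<open>w^3\<close> coefficient of \<open>2 p q + (2/3) p^3 q^3\<close> with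
  \<open>q = w + u w^3 + ...\<close> is \<open>2 p u + (2/3) p^3\<close>, and it equals
  \<open>2/3\<close> times the \<open>y\<close>-derivative of \<open>S\<close>.\<close>

lemma pd_y_S:
  assumes "t \<in> T"
  shows "pd_y (S z) t = mom S z t ^ 3 + 3 * mom S z t * potential A t"
proof -
  have 3: "{0..3} = {0, 1, 2, 3::nat}" by auto
  have "pd_y (S z) t =
      3 / 2 * (log_quotient_series oo (fps_const (mom S z t) * recip_series t)) $ 3"
    by (simp add: pd_S_eq_coeff[OF assms])
  also have "\<dots> = mom S z t ^ 3 + 3 * mom S z t * potential A t"
    using recip_series_nth[of t]
    by (simp add: fps_compose_nth 3 power_mult_distrib log_quotient_series_def algebra_simps)
  finally show ?thesis .
qed

lemma pd_y_S_z:
  assumes "t \<in> T"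
  shows "pd_y (S_z S z) t = 3 * mom S z t ^ 2 * phi S z t + 3 * phi S z t * potential A t"
proof -
  have 3: "{0..3} = {0, 1, 2, 3::nat}" by auto
  have "pd_y (S_z S z) t =
      3 / 2 * ((log_quotient_deriv_series (mom S z t) oo recip_series t) $ 3 * phi S z t)"
    by (simp add: pd_S_z_eq_coeff[OF assms])
  also have "\<dots> = 3 * mom S z t ^ 2 * phi S z t + 3 * phi S z t * potential A t"
    using recip_series_nth[of t]
    by (simp add: fps_compose_nth 3 log_quotient_deriv_series_nth algebra_simps)
  finally show ?thesis .
qed

lemma pd_y_mom:
  assumes "t \<in> T"
  shows "pd_y (mom S z) t = pd_x (\<lambda>s. mom S z s ^ 3 + 3 * mom S z s * potential A s) t"
proof -
  have "pd_y (mom S z) t = pd_x (pd_y (S z)) t"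
    unfolding mom_def[abs_def] by (rule pd_commute[OF S_time_holomorphic T_open assms])
  also have "\<dots> = pd_x (\<lambda>s. mom S z s ^ 3 + 3 * mom S z s * potential A s) t"
    by (rule pd_cong[OF T_open assms]) (rule pd_y_S)
  finally show ?thesis .
qed

text \<open>Since \<open>phi\<close> is the \<open>x\<close>-derivative of \<open>S_z\<close>,
  commuting the two times reduces the claim to \<open>pd_y_S_z\<close>.\<close>

lemma pd_y_phi:
  assumes "t \<in> T"
  shows "pd_y (phi S z) t =
           pd_x (\<lambda>s. 3 * mom S z s ^ 2 * phi S z s + 3 * phi S z s * potential A s) t"
proof -
  have "pd_y (phi S z) t = pd_x (pd_y (S_z S z)) t"
    unfolding phi_def[abs_def] by (rule pd_commute[OF S_z_time_holomorphic T_open assms])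
  also have "\<dots> = pd_x (\<lambda>s. 3 * mom S z s ^ 2 * phi S z s + 3 * phi S z s * potential A s) t"
    by (rule pd_cong[OF T_open assms]) (rule pd_y_S_z)
  finally show ?thesis .
qed

text \<open>Both sides of \<open>S_tilde = - D F\<close> are power series in \<open>w = 1/z\<close>;
  comparing coefficients opens the way from the constraint on \<open>F\<close> to the expansion of
  \<open>p\<close>.\<close>

lemma coeff_tau_function:
  assumes tau: "tau_function T S F" and t: "t \<in> T" and "n \<noteq> 0"
  shows "A n t = (if odd n then - 2 / of_nat n * pd (n div 2) F t else 0)"
proof -
  have summ: "summable (vertex_term z F t)" and eq: "S_tilde S z t = - vertex_op z F t"
    if "norm z > 1" for z
    using tau t that unfolding tau_function_def by auto
  let ?G = "Abs_fps (\<lambda>n. if odd n then 2 / of_nat n * pd (n div 2) F t else 0)"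
  have expansion: "(\<lambda>w. - vertex_op (1 / w) F t) has_fps_expansion - ?G"
    by (intro has_fps_expansion_minus vertex_op_has_fps_expansion summ)
  have "- vertex_op (1 / w) F t = S_tilde S (1 / w) t" if "w \<in> ball 0 1" for w
  proof (cases "w = 0")
    case True
    then show ?thesis by (simp add: S_tilde_0[OF t] vertex_op_def vertex_term_def)
  next
    case False
    with that have "norm (1 / w) > 1" by (simp add: norm_divide)
    then show ?thesis by (simp add: eq)
  qed
  then have eq0: "\<forall>\<^sub>F w in nhds 0. - vertex_op (1 / w) F t = S_tilde S (1 / w) t"
    by (intro eventually_nhds_in_open[of "ball 0 1", THEN eventually_mono]) auto
  from expansion have "(\<lambda>w. S_tilde S (1 / w) t) has_fps_expansion - ?G"
    by (rule has_fps_expansion_cong[OF eq0 refl, THEN iffD1])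
  then have "Abs_fps (\<lambda>n. if n = 0 then 0 else A n t) = - ?G"
    by (rule fps_expansion_unique_complex[OF S_tilde_has_fps_expansion[OF t]])
  then have "Abs_fps (\<lambda>n. if n = 0 then 0 else A n t) $ n = (- ?G) $ n" by simp
  then show ?thesis using \<open>n \<noteq> 0\<close> by (simp split: if_splits)
qed

end

section \<open>The symmetry constraint\<close>

locale constrained_dBKP_solution = dBKP_solution +
  fixes F :: "times \<Rightarrow> complex" and N :: nat and \<zeta> c :: "nat \<Rightarrow> complex"
  assumes tau: "tau_function T S F"
    and constraint: "\<And>t. t \<in> T \<Longrightarrow> pd_x F t = 1/2 * (\<Sum>i=1..N. c i * S_z S (\<zeta> i) t)"
begin

lemma pd_pd_x_tau:
  assumes t: "t \<in> T"
  shows "pd n (pd_x F) t = 1/2 * (\<Sum>i=1..N. c i * pd n (S_z S (\<zeta> i)) t)"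
proof -
  have "pd n (pd_x F) t = pd n (\<lambda>t. 1/2 * (\<Sum>i=1..N. c i * S_z S (\<zeta> i) t)) t"
    by (rule pd_cong[OF T_open t]) (rule constraint)
  also have "\<dots> = 1/2 * (\<Sum>i=1..N. c i * pd n (S_z S (\<zeta> i)) t)"
    unfolding pd_def
    by (intro DERIV_imp_deriv DERIV_cmult DERIV_sum
        S_z_time_differentiable[OF t, folded DERIV_deriv_iff_field_differentiable])
  finally show ?thesis .
qed

text \<open>The coefficients of \<open>p - z\<close> are \<open>x\<close>-derivatives of derivatives
  of \<open>F\<close>. Exchanging the order brings out \<open>F_x\<close>, into which the constraint
  is inserted.\<close>

lemma mom_series_nth:
  assumes t: "t \<in> T"
  shows "mom_series t $ n =
           (if odd n then - (\<Sum>i=1..N. c i * pd (n div 2) (S_z S (\<zeta> i)) t) / of_nat n else 0)"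
proof (cases "n = 0")
  case False
  then have "mom_series t $ n = pd_x (A n) t"
    by (simp add: mom_series_def)
  also have "\<dots> = pd_x (\<lambda>s. (if odd n then - 2 / of_nat n else 0) * pd (n div 2) F s) t"
    by (rule pd_cong[OF T_open t]) (use False in \<open>simp add: coeff_tau_function[OF tau]\<close>)
  also have "\<dots> = (if odd n then - 2 / of_nat n else 0) * pd_x (pd (n div 2) F) t"
    unfolding pd_def[of 0]
    using tau t T_open
    by (intro deriv_cmult pd_field_differentiable) (auto simp: tau_function_def)
  also have "pd_x (pd (n div 2) F) t = pd (n div 2) (pd_x F) t"
    using tau t T_open by (intro pd_commute) (auto simp: tau_function_def)
  finally show ?thesis
    using False by (cases "odd n") (simp_all add: pd_pd_x_tau[OF t] field_simps)
qed (simp add: mom_series_def)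

text \<open>Coefficient 1 belongs to the time \<open>x\<close> itself, so the derivative of
  \<open>S_z\<close> occurring there is \<open>phi\<close>.\<close>

lemma potential_eq:
  assumes "t \<in> T"
  shows "potential A t = (\<Sum>i=1..N. c i * phi S (\<zeta> i) t)"
  using mom_series_nth[OF assms, of 1] by (simp add: mom_series_def potential_def phi_def[abs_def])

text \<open>The time derivatives of \<open>S_z\<close> at the points \<open>\<zeta> i\<close> appear
  with weight \<open>- 1/n\<close> in \<open>mom_series_nth\<close> and \<open>2/n\<close> in
  \<open>pd_S_z_eq_coeff\<close>; this explains the factor \<open>- 2\<close>.\<close>

lemma mom_series_eq:
  assumes t: "t \<in> T"
  shows "fps_const (- 2) * mom_series t = (\<Sum>i=1..N. fps_const (c i * phi S (\<zeta> i) t) *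
           (log_quotient_deriv_series (mom S (\<zeta> i) t) oo recip_series t))"
proof (rule fps_ext)
  fix n
  have "(\<Sum>i=1..N. fps_const (c i * phi S (\<zeta> i) t) *
           (log_quotient_deriv_series (mom S (\<zeta> i) t) oo recip_series t)) $ n =
        (\<Sum>i=1..N. c i * ((log_quotient_deriv_series (mom S (\<zeta> i) t) oo recip_series t) $ n * phi S (\<zeta> i) t))"
    by (simp add: fps_sum_nth mult_ac)
  also have "\<dots> = (\<Sum>i=1..N. c i * (if odd n then 2 / of_nat n * pd (n div 2) (S_z S (\<zeta> i)) t else 0))"
    by (simp only: pd_S_z_eq_coeff[OF t])
  also have "\<dots> = (fps_const (- 2) * mom_series t) $ n"
    by (simp add: mom_series_nth[OF t] sum_distrib_left sum_divide_distrib mult_ac)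
  finally show "(fps_const (- 2) * mom_series t) $ n = (\<Sum>i=1..N. fps_const (c i * phi S (\<zeta> i) t) *
           (log_quotient_deriv_series (mom S (\<zeta> i) t) oo recip_series t)) $ n" ..
qed

text \<open>Both sides of \<open>mom_series_eq\<close> expand genuine functions, so these agree for
  small \<open>w\<close>. The series on the right stands for \<open>2 x / (1 - v^2 x^2)\<close> at
  \<open>x = 1/p\<close>, which is \<open>2 p / (p^2 - v^2)\<close>.\<close>

lemma sato_relation_at_infinity:
  assumes t: "t \<in> T"
  shows "\<forall>\<^sub>F z in at_infinity. z = mom S z t
           + (\<Sum>i=1..N. c i * (mom S z t * phi S (\<zeta> i) t / (mom S z t ^ 2 - mom S (\<zeta> i) t ^ 2)))"
proof -
  let ?q = "\<lambda>w. 1 / mom S (1 / w) t"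
  let ?E = "\<lambda>v x. 2 * x / (1 - v\<^sup>2 * x\<^sup>2) :: complex"
  have 1: "(\<lambda>w. (- 2) * pd_x (S_tilde S (1 / w)) t) has_fps_expansion fps_const (- 2) * mom_series t"
    by (intro has_fps_expansion_cmult_left pd_x_S_tilde_has_fps_expansion t)
  have 2: "(\<lambda>w. \<Sum>i=1..N. c i * phi S (\<zeta> i) t * ?E (mom S (\<zeta> i) t) (?q w))
             has_fps_expansion fps_const (- 2) * mom_series t"
    unfolding mom_series_eq[OF t]
  proof (intro has_fps_expansion_sum has_fps_expansion_cmult_left)
    fix i
    show "(\<lambda>w. ?E (mom S (\<zeta> i) t) (?q w)) has_fps_expansion
            (log_quotient_deriv_series (mom S (\<zeta> i) t) oo recip_series t)"
      using has_fps_expansion_compose[OF log_quotient_deriv_series_has_fps_expansion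
          recip_mom_has_fps_expansion[OF t] recip_series_0] by (simp add: o_def)
  qed
  have "\<forall>\<^sub>F w in at 0. (- 2) * pd_x (S_tilde S (1 / w)) t =
          (\<Sum>i=1..N. c i * phi S (\<zeta> i) t * ?E (mom S (\<zeta> i) t) (?q w))"
    using fps_expansion_unique_eventually[OF 1 2] by (simp add: eventually_nhds_conv_at)
  \<comment> \<open>Substituting \<open>w = inverse z\<close> moves the statement from the punctured
    neighbourhood of 0 to infinity.\<close>
  moreover have "filterlim (\<lambda>z::complex. inverse z) (at 0) at_infinity"
    by (simp add: filterlim_def at_to_infinity)
  ultimately have "\<forall>\<^sub>F z in at_infinity. (- 2) * pd_x (S_tilde S (1 / inverse z)) t =
          (\<Sum>i=1..N. c i * phi S (\<zeta> i) t * ?E (mom S (\<zeta> i) t) (?q (inverse z)))"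
    unfolding filterlim_iff by blast
  moreover have "\<forall>\<^sub>F z::complex in at_infinity. norm z \<ge> 2"
    unfolding eventually_at_infinity by blast
  ultimately show ?thesis
  proof eventually_elim
    case (elim z)
    have "norm z > 1" using elim(2) by simp
    have [simp]: "1 / inverse z = z" by (simp add: divide_inverse)
    let ?p = "mom S z t"
    have nz: "?p \<noteq> 0" by (rule mom_nonzero) fact+
    have E: "?E v (1 / ?p) = 2 * (?p / (?p\<^sup>2 - v\<^sup>2))" for v
    proof -
      have "1 - v\<^sup>2 * (1 / ?p)\<^sup>2 = (?p\<^sup>2 - v\<^sup>2) / ?p\<^sup>2"
        using nz by (simp add: field_simps)
      then show ?thesis using nz by (simp add: power2_eq_square)
    qed
    have "?p - z = pd_x (S_tilde S z) t"
      using mom_inverse[OF t, of "inverse z"] by simp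
    then have "2 * (z - ?p) = (- 2) * pd_x (S_tilde S z) t"
      by (simp add: algebra_simps)
    also have "\<dots> = (\<Sum>i=1..N. c i * phi S (\<zeta> i) t * ?E (mom S (\<zeta> i) t) (1 / ?p))"
      using elim(1) by simp
    also have "\<dots> = (\<Sum>i=1..N. 2 * (c i * (?p * phi S (\<zeta> i) t / (?p\<^sup>2 - mom S (\<zeta> i) t ^ 2))))"
      unfolding E by (intro sum.cong refl) simp
    also have "\<dots> = 2 * (\<Sum>i=1..N. c i * (?p * phi S (\<zeta> i) t / (?p\<^sup>2 - mom S (\<zeta> i) t ^ 2)))"
      by (simp only: sum_distrib_left)
    finally have "z - ?p = (\<Sum>i=1..N. c i * (?p * phi S (\<zeta> i) t / (?p\<^sup>2 - mom S (\<zeta> i) t ^ 2)))"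
      by (simp only: mult_cancel_left) simp
    then show ?case by (simp only: diff_eq_eq add.commute)
  qed
qed

lemma mom_square_neq:
  assumes "t \<in> T" "norm z > 1" "z \<noteq> w" "z \<noteq> - w"
  shows "mom S z t ^ 2 \<noteq> mom S w t ^ 2"
  using mom_neq[OF assms] mom_neq_minus[OF assms] by (simp add: power2_eq_iff)

text \<open>The two sides are holomorphic outside the unit disc apart from finitely many points and
  agree near infinity. The remaining domain is connected, so analytic continuation applies.\<close>

lemma sato_relation:
  assumes t: "t \<in> T" and z: "norm z > 1" "\<forall>i\<in>{1..N}. z \<noteq> \<zeta> i \<and> z \<noteq> - \<zeta> i"
  shows "z = mom S z t
           + (\<Sum>i=1..N. c i * (mom S z t * phi S (\<zeta> i) t / (mom S z t ^ 2 - mom S (\<zeta> i) t ^ 2)))"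
proof -
  let ?E = "\<zeta> ` {1..N} \<union> (\<lambda>i. - \<zeta> i) ` {1..N}"
  let ?U = "{z. norm z > 1} - ?E"
  let ?f = "\<lambda>z. mom S z t
           + (\<Sum>i=1..N. c i * (mom S z t * phi S (\<zeta> i) t / (mom S z t ^ 2 - mom S (\<zeta> i) t ^ 2))) - z"
  have out: "{z :: complex. norm z > 1} = - cball 0 1" by auto
  have fin: "finite ?E" by simp
  have out_open: "open (- cball (0::complex) 1)" by (intro open_Compl closed_cball)
  have U_open: "open ?U"
    unfolding out using out_open finite_imp_closed[OF fin] by (rule open_Diff)
  have U_connected: "connected ?U"
    unfolding out using out_open
    by (rule connected_open_delete_finite)
       (auto intro: connected_complement_bounded_convex simp del: image_Un)
  have hol: "?f holomorphic_on ?U"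
  proof -
    have "(\<lambda>z. mom S z t) holomorphic_on ?U"
      by (rule holomorphic_on_subset[OF mom_holomorphic[OF t]]) auto
    \<comment> \<open>The generating equation confines the zeros of the denominators to the deleted
      points.\<close>
    moreover have "mom S z t ^ 2 - mom S (\<zeta> i) t ^ 2 \<noteq> 0" if "z \<in> ?U" "i \<in> {1..N}" for z i
    proof -
      have "z \<noteq> \<zeta> i" "z \<noteq> - \<zeta> i" using that by blast+
      then show ?thesis using mom_square_neq[OF t, of z "\<zeta> i"] that by simp
    qed
    ultimately show ?thesis by (intro holomorphic_intros) auto
  qed
  have "\<forall>\<^sub>F z in at_infinity. ?f z = 0"
    using sato_relation_at_infinity[OF t]
  proof eventually_elim
    case (elim z)
    from elim[symmetric] show ?case by (simp only: diff_self)
  qed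
  then obtain b where b: "\<And>z. norm z \<ge> b \<Longrightarrow> ?f z = 0"
    unfolding eventually_at_infinity by blast
  obtain r where r: "\<And>e. e \<in> ?E \<Longrightarrow> norm e \<le> r"
    using finite_imp_bounded[OF fin] unfolding bounded_iff by blast
  \<comment> \<open>This point only witnesses that the region beyond all three bounds is nonempty:
    past \<open>b\<close> the relation holds, past \<open>r\<close> no deleted point occurs, past 1
    lies the exterior of the disc.\<close>
  define z0 :: complex where "z0 = of_real (max (max b r) 1 + 1)"
  have "norm z0 = max (max b r) 1 + 1" unfolding z0_def norm_of_real by simp
  let ?V = "{z. norm z > max (max b r) 1} :: complex set"
  have "?f z = 0"
  proof (rule analytic_continuation_open[of ?V ?U ?f "\<lambda>_. 0" z])
    show "open ?V" by (intro open_Collect_less continuous_intros)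
    show "?V \<noteq> {}" using \<open>norm z0 = _\<close> by (auto intro!: exI[of _ z0])
    show "?V \<subseteq> ?U"
    proof
      fix z assume "z \<in> ?V"
      then have "norm z > r" "norm z > 1" by auto
      then have "z \<notin> ?E" using r by (metis not_less)
      then show "z \<in> ?U" using \<open>norm z > 1\<close> by blast
    qed
    show "z \<in> ?U" using z by auto
    show "?f z = 0" if "z \<in> ?V" for z
      using that by (intro b) auto
  qed (fact U_open U_connected hol holomorphic_on_const)+
  then show ?thesis by (simp only: diff_eq_eq add_0)
qed

lemma sato_function_mom:
  assumes "t \<in> T" "norm z > 1"
  shows "sato_function S t (mom S z t) = z"
  unfolding sato_function_def by (rule the_inv_into_f_f[OF inj_on_mom]) (use assms in auto)

end

text \<open>Injectivity is stated so that \<open>sato_function\<close> is a true inverse on the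
  values of \<open>p\<close>. The points \<open>\<zeta> i\<close> and \<open>- \<zeta> i\<close> are
  left out of the Sato formula because \<open>p^2 - p_i^2\<close> vanishes there.\<close>

theorem mainTheorem10:
  fixes W :: "complex \<Rightarrow> complex \<Rightarrow> complex \<Rightarrow> complex"
    and T :: "times set"
    and S :: "complex \<Rightarrow> times \<Rightarrow> complex"
    and A :: "nat \<Rightarrow> times \<Rightarrow> complex"
    and F :: "times \<Rightarrow> complex"
    and N :: nat
    and \<zeta> c :: "nat \<Rightarrow> complex"
  assumes solution: "dBKP_solution W T S A"
    and tau: "tau_function T S F"
    and symmetry_constraint: "\<forall>t\<in>T. pd_x F t = 1/2 * (\<Sum>i=1..N. c i * S_z S (\<zeta> i) t)"
  shows
    "\<forall>t\<in>T.
       potential A t = (\<Sum>i=1..N. c i * phi S (\<zeta> i) t) \<and>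
       (\<forall>k\<in>{1..N}.
          pd_y (mom S (\<zeta> k)) t =
            pd_x (\<lambda>s. mom S (\<zeta> k) s ^ 3
                       + 3 * mom S (\<zeta> k) s * (\<Sum>i=1..N. c i * phi S (\<zeta> i) s)) t \<and>
          pd_y (phi S (\<zeta> k)) t =
            pd_x (\<lambda>s. 3 * mom S (\<zeta> k) s ^ 2 * phi S (\<zeta> k) s
                       + 3 * phi S (\<zeta> k) s * (\<Sum>i=1..N. c i * phi S (\<zeta> i) s)) t) \<and>
       inj_on (\<lambda>z. mom S z t) {z. norm z > 1} \<and>
       (\<forall>z. norm z > 1 \<longrightarrow> (\<forall>i\<in>{1..N}. z \<noteq> \<zeta> i \<and> z \<noteq> - \<zeta> i) \<longrightarrow>
          (\<forall>i\<in>{1..N}. mom S z t ^ 2 \<noteq> mom S (\<zeta> i) t ^ 2) \<and>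
          sato_function S t (mom S z t) = z \<and>
          z = mom S z t
              + (\<Sum>i=1..N. c i * (mom S z t * phi S (\<zeta> i) t
                                   / (mom S z t ^ 2 - mom S (\<zeta> i) t ^ 2))))"
proof -
  interpret constrained_dBKP_solution W T S A F N \<zeta> c
    using solution tau symmetry_constraint
    by (simp add: constrained_dBKP_solution_def constrained_dBKP_solution_axioms_def)
  show ?thesis
  proof (intro ballI conjI allI impI)
    fix t assume t: "t \<in> T"
    show "potential A t = (\<Sum>i=1..N. c i * phi S (\<zeta> i) t)"
      by (rule potential_eq[OF t])
    show "inj_on (\<lambda>z. mom S z t) {z. norm z > 1}"
      by (rule inj_on_mom[OF t])
    show "pd_y (mom S (\<zeta> k)) t =
            pd_x (\<lambda>s. mom S (\<zeta> k) s ^ 3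
                       + 3 * mom S (\<zeta> k) s * (\<Sum>i=1..N. c i * phi S (\<zeta> i) s)) t" for k
      unfolding pd_y_mom[OF t] by (rule pd_cong[OF T_open t]) (simp only: potential_eq)
    show "pd_y (phi S (\<zeta> k)) t =
            pd_x (\<lambda>s. 3 * mom S (\<zeta> k) s ^ 2 * phi S (\<zeta> k) s
                       + 3 * phi S (\<zeta> k) s * (\<Sum>i=1..N. c i * phi S (\<zeta> i) s)) t" for k
      unfolding pd_y_phi[OF t] by (rule pd_cong[OF T_open t]) (simp only: potential_eq)
    fix z assume z: "norm z > 1" "\<forall>i\<in>{1..N}. z \<noteq> \<zeta> i \<and> z \<noteq> - \<zeta> i"
    show "mom S z t ^ 2 \<noteq> mom S (\<zeta> i) t ^ 2" if "i \<in> {1..N}" for i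
      using mom_square_neq[OF t z(1)] z(2) that by blast
    show "sato_function S t (mom S z t) = z"
      by (rule sato_function_mom[OF t z(1)])
    show "z = mom S z t + (\<Sum>i=1..N. c i * (mom S z t * phi S (\<zeta> i) t
                                   / (mom S z t ^ 2 - mom S (\<zeta> i) t ^ 2)))"
      by (rule sato_relation[OF t z])
  qed
qed

end
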